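(* Let $\Gamma$ be a finite index subgroup of $\mathrm{SL}_2(\mathbb{Z})$. (1) The map $$\mathcal{Z}\mapsto\frac{H_{[1,\tau]}(\tau)}{H_{[1,\tau]}(1)},$$ defined on the set of $\Gamma$-elliptic zeta functions $\mathcal{Z}$ for which $\tau\mapsto H_{[1,\tau]}(1)$ is not identically zero, is a well-defined map to the set $Eq(\Gamma)$ of $\Gamma$-equivariant functions. (2) The map $$\mathcal{Z}\mapsto\frac{\Phi_{[1,\tau]}}{\Psi_{[1,\tau]}},$$ defined on the set of $\Gamma$-elliptic zeta functions $\mathcal{Z}$ for which $\tau\mapsto\Psi_{[1,\tau]}$ is not identically zero, is a well-defined map to $M_2(\Gamma)$. It is also onto: for each $f\in M_2(\Gamma)$, $$\mathcal{Z}([\omega_1,\omega_2],z)=\frac{1}{\omega_1^2}\,f\left(\frac{\omega_2}{\omega_1}\right)z+\zeta(\omega_1\mathbb{Z}+\omega_2\mathbb{Z},z)$$ is a $\Gamma$-elliptic zeta function of weight $-1$ that maps to $f$.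
   Context: $\mathbb{H}$ is the upper half-plane, $\gamma\tau=\frac{a\tau+b}{c\tau+d}$ for $\gamma=\begin{bmatrix}a&b\\c&d\end{bmatrix}$, and $\Lambda_{(\omega_1,\omega_2)}=\omega_1\mathbb{Z}+\omega_2\mathbb{Z}$. Weierstrass zeta function: $\zeta(\Lambda,z)=\frac1z+\sum_{\omega\in\Lambda,\,\omega\ne0}\left(\frac{1}{z-\omega}+\frac1\omega+\frac{z}{\omega^2}\right)$; its quasi-period map $\eta_\Lambda:\Lambda\to\mathbb{C}$ is defined by $\zeta(\Lambda,z+\omega)=\zeta(\Lambda,z)+\eta_\Lambda(\omega)$. $M_2(\Gamma)$ is the space of meromorphic weight two modular forms for $\Gamma$, i.e. meromorphic functions $f$ on $\mathbb{H}$ with $f(\gamma\tau)=(c\tau+d)^2f(\tau)$ for all $\gamma=\begin{bmatrix}a&b\\c&d\end{bmatrix}\in\Gamma$. $Eq(\Gamma)$ is the set of meromorphic functions $h$ on $\mathbb{H}$ with $h(\gamma\tau)=\gamma h(\tau)$ for all $\gamma\in\Gamma$, $\tau\in\mathbb{H}$. Classes: let $\mathbb{M}=\{(\omega_1,\omega_2)\in\mathbb{C}^2:\Im(\omega_2/\omega_1)>0\}$. The group $\Gamma$ acts on $\mathbb{M}$ by $\gamma(\omega_1,\omega_2)=(\omega_1,\omega_2)\gamma^t=(a\omega_1+b\omega_2,\;c\omega_1+d\omega_2)$, where $\gamma^t$ is the transpose of $\gamma$. Put $\Omega_\Gamma=\Gamma\backslash\mathbb{M}$, write $[\omega_1,\omega_2]$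 for the class of $(\omega_1,\omega_2)$, and let $\mathbb{C}^*$ act by $\alpha[\omega_1,\omega_2]=[\alpha\omega_1,\alpha\omega_2]$. A $\Gamma$-elliptic zeta function of weight $k\in\mathbb{Z}$ is a map $\mathcal{Z}:\Omega_\Gamma\times\mathbb{C}\to\mathbb{C}\cup\{\infty\}$ such that: (i) for each $[\omega_1,\omega_2]\in\Omega_\Gamma$, $\mathcal{Z}([\omega_1,\omega_2],\cdot)$ is quasi-periodic with respect to $\Lambda_{(\omega_1,\omega_2)}$: $\mathcal{Z}([\omega_1,\omega_2],z+\omega)=\mathcal{Z}([\omega_1,\omega_2],z)+H_{[\omega_1,\omega_2]}(\omega)$ for all $z\in\mathbb{C}$, $\omega\in\Lambda_{(\omega_1,\omega_2)}$, with $H_{[\omega_1,\omega_2]}(\omega)$ independent of $z$; (ii) $\mathcal{Z}(\alpha[\omega_1,\omega_2],\alpha z)=\alpha^k\mathcal{Z}([\omega_1,\omega_2],z)$ for all $\alpha\in\mathbb{C}^*$, $[\omega_1,\omega_2]\in\Omega_\Gamma$, $z\in\mathbb{C}$; (iii) $\tau\mapsto H_{[1,\tau]}(\tau)$ and $\tau\mapsto H_{[1,\tau]}(1)$ are meromorphic on $\mathbb{H}$. The maps $\Phi,\Psi$ attached to $\mathcal{Z}$ are the unique ones with $H_{[\omega_1,\omega_2]}(\omega)=\Phi_{[\omega_1,\omega_2]}\,\omega+\Psi_{[\omega_1,\omega_2]}\,\eta_{\Lambda_{(\omega_1,\omega_2)}}(\omega)$ for all $\omega\in\Lambda_{(\omega_1,\omega_2)}$;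 they exist and are unique because $\begin{bmatrix}\omega_2&\eta(\omega_2)\\ \omega_1&\eta(\omega_1)\end{bmatrix}$ (with $\eta=\eta_{\Lambda_{(\omega_1,\omega_2)}}$) is invertible. Equivalently, $\mathcal{Z}([\omega_1,\omega_2],z)=\Phi_{[\omega_1,\omega_2]}z+\Psi_{[\omega_1,\omega_2]}\zeta(\Lambda_{(\omega_1,\omega_2)},z)+E_{[\omega_1,\omega_2]}(z)$ with $E_{[\omega_1,\omega_2]}$ a $\Lambda_{(\omega_1,\omega_2)}$-elliptic function.
   Formalization: γ acts on the column (ω₂,ω₁), so ω₂/ω₁ ↦ γ(ω₂/ω₁); with the action as written (2) fails, e.g. for Γ₀(2). In (iii), τ where Z([1,τ],·) is constantly ∞ (H undetermined) must be discrete, and H is taken off them. *)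

theory Defs
  imports "HOL-Complex_Analysis.Complex_Analysis" "HOL-Algebra.Coset"
begin

subsection \<open>Functions with values in \<open>\<complex> \<union> {\<infinity>}\<close>\<close>

text \<open>\<open>None\<close> is the point \<open>\<infinity>\<close>; it absorbs in sums, so that also \<open>\<infinity> + \<infinity> = \<infinity>\<close>.\<close>

type_synonym csphere = "complex option"

fun sphere_add :: "csphere \<Rightarrow> csphere \<Rightarrow> csphere" (infixl \<open>\<oplus>\<^sub>s\<close> 65) where
  "Some x \<oplus>\<^sub>s Some y = Some (x + y)"
| "None \<oplus>\<^sub>s y = None"
| "x \<oplus>\<^sub>s None = None"

text \<open>The scalars used below are nonzero, except for the factor \<open>z\<close> in \<open>example_zeta\<close> at
  \<open>z = 0\<close>, where the other summand \<open>\<zeta>(\<Lambda>, 0)\<close> is \<open>\<infinity>\<close> anyway.\<close>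

definition sphere_scale :: "complex \<Rightarrow> csphere \<Rightarrow> csphere" (infixr \<open>\<cdot>\<^sub>s\<close> 75) where
  "a \<cdot>\<^sub>s x = map_option (\<lambda>w. a * w) x"

text \<open>The library's \<open>f meromorphic_on A\<close> disregards the values of \<open>f\<close> at isolated points.
  \<open>mero_val f\<close> is the map to \<open>\<complex> \<union> {\<infinity>}\<close> that such an \<open>f\<close> determines: removable singularities
  are removed and the value at a pole is \<open>\<infinity>\<close>.\<close>

definition mero_val :: "(complex \<Rightarrow> complex) \<Rightarrow> complex \<Rightarrow> csphere" where
  "mero_val f z = (if is_pole f z then None else Some (remove_sings f z))"

definition sphere_meromorphic_on :: "(complex \<Rightarrow> csphere) \<Rightarrow> complex set \<Rightarrow> bool" where
  "sphere_meromorphic_on F A \<longleftrightarrow> (\<exists>f. f meromorphic_on A \<and> (\<forall>z\<in>A. F z = mero_val f z))"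

subsection \<open>The modular group\<close>

definition SL2Z :: "(int^2^2) monoid" where
  "SL2Z = \<lparr>carrier = {A. det A = 1}, monoid.mult = (**), one = mat 1\<rparr>"

definition upper_half_plane :: "complex set" where
  "upper_half_plane = {\<tau>. Im \<tau> > 0}"

definition mat_moebius :: "int^2^2 \<Rightarrow> complex \<Rightarrow> complex" where
  "mat_moebius \<gamma> =
     moebius (of_int (\<gamma>$1$1)) (of_int (\<gamma>$1$2)) (of_int (\<gamma>$2$1)) (of_int (\<gamma>$2$2))"

definition sphere_moebius :: "int^2^2 \<Rightarrow> csphere \<Rightarrow> csphere" where
  "sphere_moebius \<gamma> x = (case x of
       None \<Rightarrow> (if \<gamma>$2$1 = 0 then None else Some (of_int (\<gamma>$1$1) / of_int (\<gamma>$2$1)))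
     | Some w \<Rightarrow> (if of_int (\<gamma>$2$1) * w + of_int (\<gamma>$2$2) = 0 then None
                 else Some (mat_moebius \<gamma> w)))"

text \<open>In \<open>M2\<close> and \<open>Eq\<close> only the values on the upper half-plane matter.\<close>

definition M2 :: "(int^2^2) set \<Rightarrow> (complex \<Rightarrow> csphere) set" where
  "M2 \<Gamma> = {f. sphere_meromorphic_on f upper_half_plane \<and>
     (\<forall>\<gamma>\<in>\<Gamma>. \<forall>\<tau>\<in>upper_half_plane.
        f (mat_moebius \<gamma> \<tau>) = (of_int (\<gamma>$2$1) * \<tau> + of_int (\<gamma>$2$2))\<^sup>2 \<cdot>\<^sub>s f \<tau>)}"

definition Eq :: "(int^2^2) set \<Rightarrow> (complex \<Rightarrow> csphere) set" where
  "Eq \<Gamma> = {h. sphere_meromorphic_on h upper_half_plane \<and>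
     (\<forall>\<gamma>\<in>\<Gamma>. \<forall>\<tau>\<in>upper_half_plane. h (mat_moebius \<gamma> \<tau>) = sphere_moebius \<gamma> (h \<tau>))}"

subsection \<open>Lattices and quasi-periods\<close>

definition lattice :: "complex \<Rightarrow> complex \<Rightarrow> complex set" where
  "lattice \<omega>1 \<omega>2 = {of_int m * \<omega>1 + of_int n * \<omega>2 | m n. True}"

text \<open>The series converges absolutely, hence unconditionally.\<close>

definition weierstrass_zeta :: "complex set \<Rightarrow> complex \<Rightarrow> csphere" where
  "weierstrass_zeta \<Lambda> z = (if z \<in> \<Lambda> then None else
     Some (1 / z + (\<Sum>\<^sub>\<infinity>\<omega>\<in>\<Lambda> - {0}. 1 / (z - \<omega>) + 1 / \<omega> + z / \<omega>\<^sup>2)))"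

definition quasi_periodic :: "complex set \<Rightarrow> (complex \<Rightarrow> csphere) \<Rightarrow> bool" where
  "quasi_periodic \<Lambda> F \<longleftrightarrow> (\<forall>\<omega>\<in>\<Lambda>. \<exists>h. \<forall>z. F (z + \<omega>) = F z \<oplus>\<^sub>s Some h)"

text \<open>Uniquely determined if \<open>F\<close> is quasi-periodic and not constantly \<open>\<infinity>\<close>.\<close>

definition quasi_period :: "(complex \<Rightarrow> csphere) \<Rightarrow> complex \<Rightarrow> complex" where
  "quasi_period F \<omega> = (THE h. \<forall>z. F (z + \<omega>) = F z \<oplus>\<^sub>s Some h)"

definition eta :: "complex set \<Rightarrow> complex \<Rightarrow> complex" where
  "eta \<Lambda> = quasi_period (weierstrass_zeta \<Lambda>)"

subsection \<open>Elliptic zeta functions\<close>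

definition lattice_pairs :: "(complex \<times> complex) set" where
  "lattice_pairs = {(\<omega>1, \<omega>2). \<omega>1 \<noteq> 0 \<and> Im (\<omega>2 / \<omega>1) > 0}"

text \<open>\<open>\<gamma>\<close> multiplies the column \<open>(\<omega>2, \<omega>1)\<close>, so that \<open>\<omega>2 / \<omega>1\<close> is mapped to \<open>\<gamma>(\<omega>2 / \<omega>1)\<close>.
  Letting \<open>\<gamma>\<close> multiply the column \<open>(\<omega>1, \<omega>2)\<close> instead would make \<open>\<omega>2 / \<omega>1\<close> transform by the
  matrix with rows \<open>(d, c)\<close> and \<open>(b, a)\<close>, which need not lie in the same subgroup.\<close>

definition pair_act :: "int^2^2 \<Rightarrow> complex \<times> complex \<Rightarrow> complex \<times> complex" where
  "pair_act \<gamma> = (\<lambda>(\<omega>1, \<omega>2).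
     (of_int (\<gamma>$2$1) * \<omega>2 + of_int (\<gamma>$2$2) * \<omega>1,
      of_int (\<gamma>$1$1) * \<omega>2 + of_int (\<gamma>$1$2) * \<omega>1))"

text \<open>The class \<open>[\<omega>1, \<omega>2]\<close> is the orbit. A map on \<open>\<Omega>\<^sub>\<Gamma> \<times> \<complex>\<close> is a function of a set of pairs and
  a complex number of which only the values at orbits of elements of \<open>lattice_pairs\<close> matter.\<close>

definition pair_class :: "(int^2^2) set \<Rightarrow> complex \<Rightarrow> complex \<Rightarrow> (complex \<times> complex) set" where
  "pair_class \<Gamma> \<omega>1 \<omega>2 = (\<lambda>\<gamma>. pair_act \<gamma> (\<omega>1, \<omega>2)) ` \<Gamma>"

type_synonym zeta_map = "(complex \<times> complex) set \<Rightarrow> complex \<Rightarrow> csphere"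

definition H_of ::
    "(int^2^2) set \<Rightarrow> zeta_map \<Rightarrow> complex \<Rightarrow> complex \<Rightarrow> complex \<Rightarrow> complex" where
  "H_of \<Gamma> Z \<omega>1 \<omega>2 \<omega> = quasi_period (Z (pair_class \<Gamma> \<omega>1 \<omega>2)) \<omega>"

text \<open>At a pole of \<open>f\<close>, the function \<open>z \<mapsto> f(\<tau>) z + \<zeta>(\<Lambda>, z)\<close> is constantly \<open>\<infinity>\<close>. At such points
  the quasi-periods are indeterminate and \<open>H_of\<close> has no meaning.\<close>

definition degenerate_points :: "(int^2^2) set \<Rightarrow> zeta_map \<Rightarrow> complex set" where
  "degenerate_points \<Gamma> Z = {\<tau>\<in>upper_half_plane. \<forall>z. Z (pair_class \<Gamma> 1 \<tau>) z = None}"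

definition regular_points :: "(int^2^2) set \<Rightarrow> zeta_map \<Rightarrow> complex set" where
  "regular_points \<Gamma> Z = upper_half_plane - degenerate_points \<Gamma> Z"

text \<open>Two meromorphic functions on the upper half-plane, each of them given by \<open>H\<close> wherever \<open>H\<close> is
  determined: there \<open>H\<close> is finite, so the poles are degenerate points. Discreteness of the
  degenerate points makes these meromorphic functions unique.\<close>

definition meromorphic_quasi_period ::
    "(int^2^2) set \<Rightarrow> zeta_map \<Rightarrow> (complex \<Rightarrow> complex) \<Rightarrow> bool" where
  "meromorphic_quasi_period \<Gamma> Z \<omega> \<longleftrightarrow>
     degenerate_points \<Gamma> Z sparse_in upper_half_plane \<and>
     (\<lambda>\<tau>. H_of \<Gamma> Z 1 \<tau> (\<omega> \<tau>)) holomorphic_on regular_points \<Gamma> Z \<and>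
     (\<lambda>\<tau>. H_of \<Gamma> Z 1 \<tau> (\<omega> \<tau>)) meromorphic_on upper_half_plane"

definition elliptic_zeta :: "(int^2^2) set \<Rightarrow> int \<Rightarrow> zeta_map \<Rightarrow> bool" where
  "elliptic_zeta \<Gamma> k Z \<longleftrightarrow>
     (\<forall>(\<omega>1, \<omega>2)\<in>lattice_pairs. quasi_periodic (lattice \<omega>1 \<omega>2) (Z (pair_class \<Gamma> \<omega>1 \<omega>2))) \<and>
     (\<forall>\<alpha>. \<alpha> \<noteq> 0 \<longrightarrow> (\<forall>(\<omega>1, \<omega>2)\<in>lattice_pairs. \<forall>z.
        Z (pair_class \<Gamma> (\<alpha> * \<omega>1) (\<alpha> * \<omega>2)) (\<alpha> * z) =
          (\<alpha> powi k) \<cdot>\<^sub>s Z (pair_class \<Gamma> \<omega>1 \<omega>2) z)) \<and>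
     meromorphic_quasi_period \<Gamma> Z (\<lambda>\<tau>. \<tau>) \<and>
     meromorphic_quasi_period \<Gamma> Z (\<lambda>\<tau>. 1)"

definition Phi_Psi_of ::
    "(int^2^2) set \<Rightarrow> zeta_map \<Rightarrow> complex \<Rightarrow> complex \<Rightarrow> complex \<times> complex" where
  "Phi_Psi_of \<Gamma> Z \<omega>1 \<omega>2 = (THE (\<phi>, \<psi>). \<forall>\<omega>\<in>lattice \<omega>1 \<omega>2.
     H_of \<Gamma> Z \<omega>1 \<omega>2 \<omega> = \<phi> * \<omega> + \<psi> * eta (lattice \<omega>1 \<omega>2) \<omega>)"

definition Phi_of :: "(int^2^2) set \<Rightarrow> zeta_map \<Rightarrow> complex \<Rightarrow> complex \<Rightarrow> complex" where
  "Phi_of \<Gamma> Z \<omega>1 \<omega>2 = fst (Phi_Psi_of \<Gamma> Z \<omega>1 \<omega>2)"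

definition Psi_of :: "(int^2^2) set \<Rightarrow> zeta_map \<Rightarrow> complex \<Rightarrow> complex \<Rightarrow> complex" where
  "Psi_of \<Gamma> Z \<omega>1 \<omega>2 = snd (Phi_Psi_of \<Gamma> Z \<omega>1 \<omega>2)"

text \<open>The quotients are quotients of meromorphic functions, taken on the upper half-plane.\<close>

definition H_quotient :: "(int^2^2) set \<Rightarrow> zeta_map \<Rightarrow> complex \<Rightarrow> csphere" where
  "H_quotient \<Gamma> Z = mero_val (\<lambda>\<tau>. H_of \<Gamma> Z 1 \<tau> \<tau> / H_of \<Gamma> Z 1 \<tau> 1)"

definition Phi_Psi_quotient :: "(int^2^2) set \<Rightarrow> zeta_map \<Rightarrow> complex \<Rightarrow> csphere" where
  "Phi_Psi_quotient \<Gamma> Z = mero_val (\<lambda>\<tau>. Phi_of \<Gamma> Z 1 \<tau> / Psi_of \<Gamma> Z 1 \<tau>)"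

definition zeta_H_nonzero :: "(int^2^2) set \<Rightarrow> zeta_map set" where
  "zeta_H_nonzero \<Gamma> =
     {Z. (\<exists>k. elliptic_zeta \<Gamma> k Z) \<and> (\<exists>\<tau>\<in>regular_points \<Gamma> Z. H_of \<Gamma> Z 1 \<tau> 1 \<noteq> 0)}"

definition zeta_Psi_nonzero :: "(int^2^2) set \<Rightarrow> zeta_map set" where
  "zeta_Psi_nonzero \<Gamma> =
     {Z. (\<exists>k. elliptic_zeta \<Gamma> k Z) \<and> (\<exists>\<tau>\<in>regular_points \<Gamma> Z. Psi_of \<Gamma> Z 1 \<tau> \<noteq> 0)}"

definition example_zeta :: "(complex \<Rightarrow> csphere) \<Rightarrow> complex \<Rightarrow> complex \<Rightarrow> complex \<Rightarrow> csphere" where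
  "example_zeta f \<omega>1 \<omega>2 z =
     (1 / \<omega>1\<^sup>2) \<cdot>\<^sub>s z \<cdot>\<^sub>s f (\<omega>2 / \<omega>1) \<oplus>\<^sub>s weierstrass_zeta (lattice \<omega>1 \<omega>2) z"

end

(*
  The quasi-period map of the Weierstrass zeta function is computed from its series without any
  contour integral: eta(w) = zeta(w/2) - zeta(-w/2). Hence eta(1) and eta(tau) are locally
  uniformly convergent series, holomorphic in tau, and summing tau * eta(1) - eta(tau) over
  rectangles telescopes to a cotangent sum whose imaginary part stays away from 0. This replaces
  Legendre's relation and makes Phi, Psi meromorphic.

  Homogeneity and the invariance of classes under Gamma give, for j = c tau + d,
  H_{[1, gamma tau]}(w) = j^(-k) H_{[1, tau]}(j w). By additivity of H the pair (H(tau), H(1))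
  transforms by gamma up to the factor j^(-k), so its quotient is equivariant; comparing with
  eta_{gamma tau}(w) = j eta_tau(j w), Phi and Psi acquire the factors j^(1-k) and j^(-1-k), so
  their quotient has weight 2. At poles and at degenerate points these identities are recovered by
  passing to limits, since they hold on a punctured neighbourhood of every point.
*)
theory Submission
  imports Defs
begin

unbundle no fps_syntax

section \<open>Quasi-periods of the Weierstrass zeta function\<close>

text \<open>The sum of 1 / \<omega>^2 over a lattice does not converge absolutely, so the zeta
  series depends on its compensators. Evaluating at the symmetric points w/2 and - w/2 removes the
  terms 1 / \<omega> and leaves summands of order |\<omega>|^-4; this gives the quasi-periods a
  majorant that is locally uniform in \<tau>. The two telescoping halves of \<tau> * \<eta>(1) -
  \<eta>(\<tau>) are only of order |\<omega>|^-2 each and cannot be summed separately over the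
  lattice. They are separated on finite rectangles, whose height is fixed before the width grows.
  Division by zero shapes several statements. With 1 / 0 = 0 the isolated pole term, and points w/2
  that happen to lie in the lattice, need no separate formulas. On the other hand a quotient that
  stays at the pole of a Moebius map would get the value 0 instead of \<infinity>, and this case has
  to be excluded.\<close>

lemma
  fixes f g :: "'a \<Rightarrow> 'b :: {topological_ab_group_add, t2_space}"
  assumes "f summable_on A" and "g summable_on A"
  shows summable_on_diff: "(\<lambda>x. f x - g x) summable_on A"
    and infsum_diff: "(\<Sum>\<^sub>\<infinity>x\<in>A. f x - g x) = infsum f A - infsum g A"
  using summable_on_add[OF assms(1), of "\<lambda>x. - g x"] infsum_add[OF assms(1), of "\<lambda>x. - g x"] assms(2)
  by (simp_all add: summable_on_uminus infsum_uminus)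

lemma quasi_period_eqI:
  assumes "\<exists>z. F z \<noteq> None" and "\<And>z. F (z + \<omega>) = F z \<oplus>\<^sub>s Some h"
  shows "quasi_period F \<omega> = h"
  unfolding quasi_period_def
proof (rule the_equality)
  show "\<forall>z. F (z + \<omega>) = F z \<oplus>\<^sub>s Some h"
    using assms(2) by blast
next
  obtain z0 where z0: "F z0 \<noteq> None"
    using assms(1) by blast
  fix h' assume "\<forall>z. F (z + \<omega>) = F z \<oplus>\<^sub>s Some h'"
  hence "F z0 \<oplus>\<^sub>s Some h' = F z0 \<oplus>\<^sub>s Some h"
    using assms(2)[of z0] by metis
  thus "h' = h"
    using z0 by (cases "F z0") auto
qed

text \<open>Summability of the inverse cubes stands in for discreteness: it forces bounded parts of
  \<Lambda> to be finite, and it passes to scaled lattices without choosing a basis. The point 0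
  contributes 1 / 0 = 0.\<close>

locale zeta_lattice =
  fixes \<Lambda> :: "complex set"
  assumes zero_mem: "0 \<in> \<Lambda>"
    and diff_mem: "\<And>x y. x \<in> \<Lambda> \<Longrightarrow> y \<in> \<Lambda> \<Longrightarrow> x - y \<in> \<Lambda>"
    and summable_inverse_cubes: "(\<lambda>\<omega>. 1 / norm \<omega> ^ 3) summable_on \<Lambda>"

definition zeta_term :: "complex \<Rightarrow> complex \<Rightarrow> complex" where
  "zeta_term z \<omega> = 1 / (z - \<omega>) + 1 / \<omega> + z / \<omega>\<^sup>2"

definition eta_term :: "complex \<Rightarrow> complex \<Rightarrow> complex" where
  "eta_term w \<omega> = 1 / (w / 2 - \<omega>) + 1 / (w / 2 + \<omega>) + w / \<omega>\<^sup>2"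

lemma eta_term_conv_zeta_term: "eta_term w \<omega> = zeta_term (w / 2) \<omega> - zeta_term (- w / 2) \<omega>"
proof -
  have "1 / (- w / 2 - \<omega>) = - (1 / (w / 2 + \<omega>))"
    by (metis (no_types, lifting) minus_add_distrib minus_divide_left minus_divide_right uminus_add_conv_diff add.commute)
  moreover have "w / \<omega>\<^sup>2 = w / 2 / \<omega>\<^sup>2 - (- w / 2) / \<omega>\<^sup>2"
    by (simp add: field_simps)
  ultimately show ?thesis
    unfolding eta_term_def zeta_term_def by (simp add: algebra_simps)
qed

context zeta_lattice
begin

lemma uminus_mem: "x \<in> \<Lambda> \<Longrightarrow> - x \<in> \<Lambda>"
  using diff_mem[OF zero_mem] by fastforce

lemma add_mem: "x \<in> \<Lambda> \<Longrightarrow> y \<in> \<Lambda> \<Longrightarrow> x + y \<in> \<Lambda>"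
  using diff_mem[of x "- y"] uminus_mem by simp

lemma add_mem_iff: "w \<in> \<Lambda> \<Longrightarrow> z + w \<in> \<Lambda> \<longleftrightarrow> z \<in> \<Lambda>"
  using add_mem[of z w] diff_mem[of "z + w" w] by auto

lemma bij_betw_add: "w \<in> \<Lambda> \<Longrightarrow> bij_betw (\<lambda>\<omega>. \<omega> + w) \<Lambda> \<Lambda>"
  by (rule bij_betw_byWitness[of _ "\<lambda>\<omega>. \<omega> - w"]) (auto intro: add_mem diff_mem)

lemma bij_betw_reflect: "w \<in> \<Lambda> \<Longrightarrow> bij_betw (\<lambda>\<omega>. - \<omega> - w) \<Lambda> \<Lambda>"
  by (rule bij_betw_byWitness[of _ "\<lambda>\<omega>. - \<omega> - w"]) (auto intro: uminus_mem diff_mem)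

text \<open>Infinitely many points in a bounded set would each contribute at least 1 / r^3 to a
  convergent sum.\<close>

lemma finite_norm_le: "finite {\<omega>\<in>\<Lambda>. norm \<omega> \<le> r}"
proof (rule ccontr)
  assume inf: "infinite {\<omega>\<in>\<Lambda>. norm \<omega> \<le> r}"
  define A where "A = {\<omega>\<in>\<Lambda>. norm \<omega> \<le> r} - {0}"
  have A: "infinite A"
    using inf by (simp add: A_def)
  then obtain \<omega>0 where "\<omega>0 \<in> A"
    by fastforce
  hence r: "r > 0"
    using zero_less_norm_iff[of \<omega>0] by (auto simp: A_def simp del: zero_less_norm_iff)
  have "(\<lambda>\<omega>. 1 / norm \<omega> ^ 3) summable_on A"
    by (rule summable_on_subset_banach[OF summable_inverse_cubes]) (auto simp: A_def)
  hence "(\<lambda>\<omega>. 1 / r ^ 3) summable_on A"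
  proof (rule summable_on_comparison_test)
    fix \<omega> assume "\<omega> \<in> A"
    thus "1 / r ^ 3 \<le> 1 / norm \<omega> ^ 3"
      by (intro divide_left_mono power_mono mult_pos_pos) (use r in \<open>auto simp: A_def\<close>)
  qed (use r in auto)
  thus False
    using infsum_diverge_constant[of A "1 / r ^ 3"] A r by simp
qed

text \<open>This supplies a point where zeta is finite, without which its quasi-periods would not be
  unique.\<close>

lemma proper: "\<exists>z. z \<notin> \<Lambda>"
proof (rule ccontr)
  assume "\<not> ?thesis"
  hence "{\<omega>\<in>\<Lambda>. norm \<omega> \<le> 1} = cball 0 1"
    by (auto simp: dist_norm)
  moreover have "infinite (cball (0 :: complex) 1)"
    using countable_finite uncountable_cball[of 1 "0 :: complex"] by auto
  ultimately show False
    using finite_norm_le[of 1] by simp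
qed

text \<open>Over a common denominator the summand is z^2 / (\<omega>^2 * (z - \<omega>)), and |z -
  \<omega>| \<ge> |\<omega>| / 2 once |\<omega>| > 2 * |z|. The finite exceptional set also absorbs
  \<omega> = 0 and a possible pole \<omega> = z, where the common denominator vanishes.\<close>

lemma summable_zeta_term: "zeta_term z summable_on \<Lambda>"
proof -
  define A where "A = {\<omega>\<in>\<Lambda>. norm \<omega> \<le> 2 * norm z}"
  have "(\<lambda>\<omega>. norm (zeta_term z \<omega>)) summable_on (\<Lambda> - A)"
  proof (rule Infinite_Sum.abs_summable_on_comparison_test')
    show "(\<lambda>\<omega>. 2 * (norm z)\<^sup>2 * (1 / norm \<omega> ^ 3)) summable_on (\<Lambda> - A)"
      by (intro summable_on_cmult_right summable_on_subset_banach[OF summable_inverse_cubes]) auto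
  next
    fix \<omega> assume "\<omega> \<in> \<Lambda> - A"
    hence *: "norm \<omega> > 2 * norm z"
      by (auto simp: A_def)
    hence nz: "\<omega> \<noteq> 0" "z - \<omega> \<noteq> 0"
      by auto
    have "norm \<omega> \<le> norm (z - \<omega>) + norm z"
      by norm
    with * have le: "norm (z - \<omega>) \<ge> norm \<omega> / 2"
      by linarith
    have "zeta_term z \<omega> = z\<^sup>2 / (\<omega>\<^sup>2 * (z - \<omega>))"
      using nz unfolding zeta_term_def by (simp add: divide_simps) (simp add: algebra_simps power2_eq_square)
    hence "norm (zeta_term z \<omega>) = (norm z)\<^sup>2 / ((norm \<omega>)\<^sup>2 * norm (z - \<omega>))"
      by (simp add: norm_divide norm_mult norm_power)
    also have "\<dots> \<le> (norm z)\<^sup>2 / ((norm \<omega>)\<^sup>2 * (norm \<omega> / 2))"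
      by (intro divide_left_mono mult_left_mono le mult_pos_pos) (use nz in auto)
    also have "\<dots> = 2 * (norm z)\<^sup>2 * (1 / norm \<omega> ^ 3)"
      by (simp add: power2_eq_square power3_eq_cube)
    finally show "norm (zeta_term z \<omega>) \<le> 2 * (norm z)\<^sup>2 * (1 / norm \<omega> ^ 3)" .
  qed
  hence "zeta_term z summable_on (\<Lambda> - A)"
    by (rule abs_summable_summable)
  moreover have "finite A"
    unfolding A_def by (rule finite_norm_le)
  ultimately have "zeta_term z summable_on (A \<union> (\<Lambda> - A))"
    by (intro summable_on_union) simp_all
  also have "A \<union> (\<Lambda> - A) = \<Lambda>"
    by (auto simp: A_def)
  finally show ?thesis .
qed

text \<open>Since \<open>1 / 0 = 0\<close>, the summand \<open>zeta_term z 0\<close> is the isolated term \<open>1 / z\<close>.\<close>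

lemma weierstrass_zeta_eq:
  "weierstrass_zeta \<Lambda> z = (if z \<in> \<Lambda> then None else Some (\<Sum>\<^sub>\<infinity>\<omega>\<in>\<Lambda>. zeta_term z \<omega>))"
proof -
  have "(\<Sum>\<^sub>\<infinity>\<omega>\<in>insert 0 (\<Lambda> - {0}). zeta_term z \<omega>) =
      zeta_term z 0 + (\<Sum>\<^sub>\<infinity>\<omega>\<in>\<Lambda> - {0}. zeta_term z \<omega>)"
    by (rule infsum_insert) (auto intro!: summable_on_subset_banach[OF summable_zeta_term])
  hence "(\<Sum>\<^sub>\<infinity>\<omega>\<in>\<Lambda>. zeta_term z \<omega>) =
      1 / z + (\<Sum>\<^sub>\<infinity>\<omega>\<in>\<Lambda> - {0}. 1 / (z - \<omega>) + 1 / \<omega> + z / \<omega>\<^sup>2)"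
    using zero_mem by (simp add: insert_absorb zeta_term_def)
  thus ?thesis
    by (simp add: weierstrass_zeta_def)
qed

text \<open>The reflection \<open>\<omega> \<mapsto> - \<omega> - w\<close> exchanges the two terms.\<close>

lemma infsum_inverse_square_shift:
  assumes "w \<in> \<Lambda>"
  shows "(\<Sum>\<^sub>\<infinity>\<omega>\<in>\<Lambda>. 1 / (\<omega> + w)\<^sup>2 - 1 / \<omega>\<^sup>2) = 0"
proof -
  have sq: "(- \<omega> - w)\<^sup>2 = (\<omega> + w)\<^sup>2" for \<omega> :: complex
    by (simp add: power2_eq_square algebra_simps)
  have "(\<Sum>\<^sub>\<infinity>\<omega>\<in>\<Lambda>. 1 / (\<omega> + w)\<^sup>2 - 1 / \<omega>\<^sup>2) =
      (\<Sum>\<^sub>\<infinity>\<omega>\<in>\<Lambda>. 1 / (- \<omega> - w + w)\<^sup>2 - 1 / (- \<omega> - w)\<^sup>2)"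
    by (rule infsum_reindex_bij_betw[OF bij_betw_reflect[OF assms], symmetric])
  also have "\<dots> = (\<Sum>\<^sub>\<infinity>\<omega>\<in>\<Lambda>. - (1 / (\<omega> + w)\<^sup>2 - 1 / \<omega>\<^sup>2))"
    by (simp add: sq)
  also have "\<dots> = - (\<Sum>\<^sub>\<infinity>\<omega>\<in>\<Lambda>. 1 / (\<omega> + w)\<^sup>2 - 1 / \<omega>\<^sup>2)"
    by (rule infsum_uminus)
  finally show ?thesis
    by simp
qed

text \<open>After reindexing \<omega> to \<omega> + w the pole terms match, the terms 1 / \<omega>
  drop out of the difference of two base points, and only z - z' times the vanishing sum of
  \<open>infsum_inverse_square_shift\<close> is left. With 1 / 0 = 0 the computation is valid at
  lattice points too, which matters when w/2 lies in \<Lambda>.\<close>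

lemma infsum_zeta_term_shift:
  assumes "w \<in> \<Lambda>"
  shows "infsum (zeta_term (z + w)) \<Lambda> - infsum (zeta_term z) \<Lambda> =
    infsum (zeta_term (z' + w)) \<Lambda> - infsum (zeta_term z') \<Lambda>"
proof -
  define d where "d = (\<lambda>u v \<omega>. zeta_term u \<omega> - zeta_term v \<omega>)"
  have d: "d u v summable_on \<Lambda>" "infsum (d u v) \<Lambda> = infsum (zeta_term u) \<Lambda> - infsum (zeta_term v) \<Lambda>" for u v
    unfolding d_def by (simp_all add: summable_on_diff infsum_diff summable_zeta_term)
  have "infsum (d (z + w) (z' + w)) \<Lambda> - infsum (d z z') \<Lambda> =
      (\<Sum>\<^sub>\<infinity>\<omega>\<in>\<Lambda>. d (z + w) (z' + w) (\<omega> + w)) - infsum (d z z') \<Lambda>"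
    by (simp add: infsum_reindex_bij_betw[OF bij_betw_add[OF assms], of "d (z + w) (z' + w)"])
  also have "\<dots> = (\<Sum>\<^sub>\<infinity>\<omega>\<in>\<Lambda>. d (z + w) (z' + w) (\<omega> + w) - d z z' \<omega>)"
    by (intro infsum_diff[symmetric])
       (simp_all add: d summable_on_reindex_bij_betw[OF bij_betw_add[OF assms], of "d (z + w) (z' + w)"])
  also have "\<dots> = (\<Sum>\<^sub>\<infinity>\<omega>\<in>\<Lambda>. (z - z') * (1 / (\<omega> + w)\<^sup>2 - 1 / \<omega>\<^sup>2))"
    by (intro infsum_cong) (simp add: d_def zeta_term_def algebra_simps diff_divide_distrib add_divide_distrib)
  also have "\<dots> = 0"
    by (simp add: infsum_cmult_right' infsum_inverse_square_shift[OF assms])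
  finally show ?thesis
    by (simp add: d algebra_simps)
qed

text \<open>The second base point - w/2 is moved to w/2, which evaluates the constant. For z in
  \<Lambda> both sides are \<infinity>.\<close>

lemma weierstrass_zeta_shift:
  assumes "w \<in> \<Lambda>"
  shows "weierstrass_zeta \<Lambda> (z + w) = weierstrass_zeta \<Lambda> z \<oplus>\<^sub>s Some (infsum (eta_term w) \<Lambda>)"
proof -
  have "infsum (zeta_term (z + w)) \<Lambda> - infsum (zeta_term z) \<Lambda> =
      infsum (zeta_term (- w / 2 + w)) \<Lambda> - infsum (zeta_term (- w / 2)) \<Lambda>"
    by (rule infsum_zeta_term_shift[OF assms])
  also have "- w / 2 + w = w / 2"
    by simp
  also have "infsum (zeta_term (w / 2)) \<Lambda> - infsum (zeta_term (- w / 2)) \<Lambda> = infsum (eta_term w) \<Lambda>"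
    using infsum_diff[OF summable_zeta_term[of "w / 2"] summable_zeta_term[of "- w / 2"]]
    by (simp add: eta_term_conv_zeta_term[abs_def])
  finally show ?thesis
    by (simp add: weierstrass_zeta_eq add_mem_iff[OF assms] diff_eq_eq add.commute[of _ "infsum (zeta_term z) \<Lambda>"])
qed

lemma summable_eta_term: "eta_term w summable_on \<Lambda>"
  using summable_on_diff[OF summable_zeta_term[of "w / 2"] summable_zeta_term[of "- w / 2"]]
  by (simp add: eta_term_conv_zeta_term[abs_def])

lemma weierstrass_zeta_finite: "\<exists>z. weierstrass_zeta \<Lambda> z \<noteq> None"
  using proper by (auto simp: weierstrass_zeta_eq)

lemma eta_eq: "w \<in> \<Lambda> \<Longrightarrow> eta \<Lambda> w = infsum (eta_term w) \<Lambda>"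
  unfolding eta_def by (intro quasi_period_eqI weierstrass_zeta_finite weierstrass_zeta_shift)

lemma quasi_periodic_weierstrass_zeta: "quasi_periodic \<Lambda> (weierstrass_zeta \<Lambda>)"
  unfolding quasi_periodic_def using weierstrass_zeta_shift by blast

end

section \<open>Homogeneity of the zeta function\<close>

lemma zeta_lattice_scale:
  assumes "zeta_lattice \<Lambda>" and "\<alpha> \<noteq> 0"
  shows "zeta_lattice ((*) \<alpha> ` \<Lambda>)"
proof -
  interpret zeta_lattice \<Lambda> by fact
  have "(\<lambda>\<omega>. 1 / norm (\<alpha> * \<omega>) ^ 3) summable_on \<Lambda>"
    using summable_on_cmult_right[OF summable_inverse_cubes, of "1 / norm \<alpha> ^ 3"]
    by (simp add: norm_mult power_mult_distrib)
  hence "(\<lambda>\<omega>. 1 / norm \<omega> ^ 3) summable_on ((*) \<alpha> ` \<Lambda>)"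
    using assms(2) by (subst summable_on_reindex) (auto simp: inj_on_def o_def)
  moreover have "x - y \<in> (*) \<alpha> ` \<Lambda>" if "x \<in> (*) \<alpha> ` \<Lambda>" "y \<in> (*) \<alpha> ` \<Lambda>" for x y
    using that diff_mem by (auto simp flip: right_diff_distrib)
  ultimately show ?thesis
    using zero_mem by unfold_locales (auto intro: image_eqI[of _ _ 0])
qed

lemma weierstrass_zeta_scale:
  assumes "\<alpha> \<noteq> 0"
  shows "weierstrass_zeta ((*) \<alpha> ` \<Lambda>) (\<alpha> * z) = (1 / \<alpha>) \<cdot>\<^sub>s weierstrass_zeta \<Lambda> z"
proof -
  have im: "(*) \<alpha> ` \<Lambda> - {0} = (*) \<alpha> ` (\<Lambda> - {0})"
    using assms by auto
  have "1 / (\<alpha> * z - \<alpha> * \<omega>) + 1 / (\<alpha> * \<omega>) + \<alpha> * z / (\<alpha> * \<omega>)\<^sup>2 =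
      (1 / \<alpha>) * (1 / (z - \<omega>) + 1 / \<omega> + z / \<omega>\<^sup>2)" for \<omega>
    using assms by (simp add: power_mult_distrib power2_eq_square distrib_left flip: right_diff_distrib)
  hence "(\<Sum>\<^sub>\<infinity>\<omega>\<in>(*) \<alpha> ` \<Lambda> - {0}. 1 / (\<alpha> * z - \<omega>) + 1 / \<omega> + \<alpha> * z / \<omega>\<^sup>2) =
      1 / \<alpha> * (\<Sum>\<^sub>\<infinity>\<omega>\<in>\<Lambda> - {0}. 1 / (z - \<omega>) + 1 / \<omega> + z / \<omega>\<^sup>2)"
    unfolding im using assms
    by (subst infsum_reindex) (auto simp: inj_on_def o_def infsum_cmult_right' simp flip: times_divide_eq_left)
  thus ?thesis
    using assms by (auto simp: weierstrass_zeta_def sphere_scale_def add_divide_distrib)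
qed

section \<open>Lattices \<open>\<int> + \<int>\<tau>\<close> and holomorphy of the quasi-periods\<close>

text \<open>The l1 norm of the coordinates is comparable to |m + n * \<tau>| with constants that are
  uniform for \<tau> in compact sets, so one majorant serves all nearby lattices.\<close>

definition taxicab :: "int \<times> int \<Rightarrow> real" where
  "taxicab p = \<bar>real_of_int (fst p)\<bar> + \<bar>real_of_int (snd p)\<bar>"

lemma taxicab_ge_1: "p \<noteq> (0, 0) \<Longrightarrow> taxicab p \<ge> 1"
  by (cases p) (auto simp: taxicab_def)

lemma summable_int_iff:
  fixes f :: "int \<Rightarrow> real"
  shows "f summable_on UNIV \<longleftrightarrow> (\<lambda>n. f (int n)) summable_on UNIV \<and> (\<lambda>n. f (- int n)) summable_on UNIV"
proof -
  have UNIV: "(UNIV :: int set) = range int \<union> range (\<lambda>n. - int n)"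
    by (auto simp: image_iff intro: int_cases2)
  have "inj (\<lambda>n. - int n)"
    by (auto simp: inj_on_def)
  hence "(\<lambda>n. f (int n)) summable_on UNIV \<longleftrightarrow> f summable_on range int"
    "(\<lambda>n. f (- int n)) summable_on UNIV \<longleftrightarrow> f summable_on range (\<lambda>n. - int n)"
    by (simp_all add: summable_on_reindex o_def)
  moreover have "f summable_on UNIV" if "f summable_on range int" "f summable_on range (\<lambda>n. - int n)"
    using summable_on_union[OF that] unfolding UNIV[symmetric] .
  ultimately show ?thesis
    using summable_on_subset_banach[OF _ subset_UNIV, of f] by blast
qed

lemma summable_int_powr: "(\<lambda>m. (1 + \<bar>real_of_int m\<bar>) powr (- 3 / 2)) summable_on UNIV"
proof -
  have "summable (\<lambda>n. real (Suc n) powr (- 3 / 2))"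
    using summable_Suc_iff[of "\<lambda>n. real n powr (- 3 / 2)"] by (simp add: summable_real_powr_iff)
  hence "(\<lambda>n. real (Suc n) powr (- 3 / 2)) summable_on UNIV"
    by (subst summable_on_UNIV_nonneg_real_iff) auto
  thus ?thesis
    unfolding summable_int_iff by simp
qed

text \<open>The exponent 3 is split evenly between the coordinates. Off the origin 1 + |m| and 1 +
  |n| are at most 2 * \<open>taxicab p\<close>, so their product to the power 3/2 is at most 8 *
  \<open>taxicab p ^ 3\<close>, and two convergent series with exponent 3/2 > 1 multiply to a
  majorant.\<close>

lemma summable_taxicab_cube: "(\<lambda>p. 1 / taxicab p ^ 3) summable_on UNIV"
proof -
  define g where "g = (\<lambda>m. (1 + \<bar>real_of_int m\<bar>) powr (- 3 / 2))"
  have g: "g summable_on UNIV"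
    unfolding g_def by (rule summable_int_powr)
  have "(\<lambda>(m, n). g m * g n) summable_on UNIV \<times> UNIV"
  proof (rule summable_on_SigmaI)
    show "((\<lambda>n. case (m, n) of (m, n) \<Rightarrow> g m * g n) has_sum (g m * infsum g UNIV)) UNIV" for m
      using g by (simp add: has_sum_cmult_right has_sum_infsum)
    show "(\<lambda>m. g m * infsum g UNIV) summable_on UNIV"
      using g by (rule summable_on_cmult_left)
  qed (auto simp: g_def)
  hence *: "(\<lambda>p. 8 * (g (fst p) * g (snd p))) summable_on UNIV"
    by (intro summable_on_cmult_right) (simp add: case_prod_unfold)
  have square_powr: "(u ^ 2) powr (3 / 2) = u ^ 3" if "u > 0" for u :: real
  proof -
    have "(u powr 2) powr (3 / 2) = u powr 3"
      by (simp only: powr_powr) simp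
    thus ?thesis
      using that by simp
  qed
  show ?thesis
    using *
  proof (rule summable_on_comparison_test)
    fix p :: "int \<times> int"
    show "1 / taxicab p ^ 3 \<le> 8 * (g (fst p) * g (snd p))"
    proof (cases "p = (0, 0)")
      case False
      define x y where "x = 1 + \<bar>real_of_int (fst p)\<bar>" and "y = 1 + \<bar>real_of_int (snd p)\<bar>"
      have T: "taxicab p \<ge> 1" "x \<ge> 1" "y \<ge> 1"
        using taxicab_ge_1[OF False] by (auto simp: x_def y_def)
      have "x * y \<le> (2 * taxicab p) ^ 2"
        unfolding power2_eq_square
        by (rule mult_mono) (use T in \<open>auto simp: x_def y_def taxicab_def\<close>)
      hence "(x * y) powr (3 / 2) \<le> ((2 * taxicab p) ^ 2) powr (3 / 2)"
        using T by (intro powr_mono2) auto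
      also have "\<dots> = (2 * taxicab p) ^ 3"
        by (rule square_powr) (use T in simp)
      finally have "1 / (8 * taxicab p ^ 3) \<le> 1 / (x * y) powr (3 / 2)"
        using T by (intro divide_left_mono) (auto simp: power_mult_distrib)
      also have "1 / (x * y) powr (3 / 2) = g (fst p) * g (snd p)"
        using T by (simp add: g_def x_def y_def powr_mult powr_minus_divide)
      finally show ?thesis
        by simp
    qed (simp add: taxicab_def g_def)
  qed (simp add: taxicab_def)
qed

definition lattice_point :: "complex \<Rightarrow> int \<times> int \<Rightarrow> complex" where
  "lattice_point \<tau> p = of_int (fst p) + of_int (snd p) * \<tau>"

lemma lattice_eq_range: "lattice 1 \<tau> = range (lattice_point \<tau>)"
  by (auto simp: lattice_def lattice_point_def image_def)

text \<open>The imaginary part alone controls y, and x is then recovered from the triangle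
  inequality. The constant depends on \<tau> only through y0 and R, so it serves a whole
  disc.\<close>

lemma norm_real_combination_ge:
  fixes \<tau> :: complex and x y :: real
  assumes "0 < y0" and "y0 \<le> Im \<tau>" and "norm \<tau> \<le> R"
  shows "y0 / (y0 + R + 1) * (\<bar>x\<bar> + \<bar>y\<bar>) \<le> norm (of_real x + of_real y * \<tau>)"
proof -
  define w where "w = of_real x + of_real y * \<tau>"
  have R: "R \<ge> 0"
    using assms(3) norm_ge_zero order_trans by blast
  have "\<bar>y\<bar> * y0 \<le> \<bar>y\<bar> * \<bar>Im \<tau>\<bar>"
    using assms by (intro mult_left_mono) auto
  also have "\<dots> = \<bar>Im w\<bar>"
    by (simp add: w_def abs_mult)
  also have "\<dots> \<le> norm w"
    by (rule abs_Im_le_cmod)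
  finally have y: "\<bar>y\<bar> * y0 \<le> norm w" .
  have "\<bar>x\<bar> = norm (w - of_real y * \<tau>)"
    by (simp add: w_def)
  also have "\<dots> \<le> norm w + norm (of_real y * \<tau>)"
    by (rule norm_triangle_ineq4)
  also have "norm (of_real y * \<tau>) \<le> \<bar>y\<bar> * R"
    using assms(3) by (simp add: norm_mult mult_left_mono)
  finally have "y0 * (\<bar>x\<bar> + \<bar>y\<bar>) \<le> y0 * (norm w + \<bar>y\<bar> * R + \<bar>y\<bar>)"
    using assms(1) by (intro mult_left_mono) auto
  also have "\<dots> = y0 * norm w + (\<bar>y\<bar> * y0) * (R + 1)"
    by (simp add: algebra_simps)
  also have "\<dots> \<le> y0 * norm w + norm w * (R + 1)"
    using y R by (intro add_left_mono mult_right_mono) auto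
  finally show ?thesis
    using assms(1) R unfolding w_def[symmetric] by (simp add: field_simps)
qed

lemma norm_lattice_point_ge:
  assumes "0 < y0" and "y0 \<le> Im \<tau>" and "norm \<tau> \<le> R"
  shows "y0 / (y0 + R + 1) * taxicab p \<le> norm (lattice_point \<tau> p)"
  using norm_real_combination_ge[OF assms, of "of_int (fst p)" "of_int (snd p)"]
  by (simp add: lattice_point_def taxicab_def)

text \<open>The half-lattice points \<open>1 / 2\<close> and \<open>\<tau> / 2\<close> stay away from the lattice because an odd
  integer has absolute value at least one.\<close>

lemma norm_half_period_shift_ge:
  assumes "0 < y0" and "y0 \<le> Im \<tau>" and "norm \<tau> \<le> R" and "w = 1 \<or> w = \<tau>"
  shows "y0 / (y0 + R + 1) / 2 * taxicab p \<le> norm (w / 2 + lattice_point \<tau> p)"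
    and "y0 / (y0 + R + 1) / 2 * taxicab p \<le> norm (w / 2 - lattice_point \<tau> p)"
proof -
  define c where "c = y0 / (y0 + R + 1)"
  have R: "R \<ge> 0"
    using assms(3) norm_ge_zero order_trans by blast
  hence c: "c > 0"
    using assms(1) by (simp add: c_def)
  have *: "c / 2 * taxicab p \<le> norm (w / 2 + lattice_point \<tau> p)" for p
  proof -
    define a b :: int where "a = (if w = 1 then 1 else 0)" and "b = (if w = 1 then 0 else 1)"
    have w: "w = of_int a + of_int b * \<tau>"
      using assms(4) by (auto simp: a_def b_def)
    have ab: "\<bar>fst p\<bar> \<le> \<bar>a + 2 * fst p\<bar>" "\<bar>snd p\<bar> \<le> \<bar>b + 2 * snd p\<bar>"
      by (auto simp: a_def b_def)
    hence "taxicab p \<le> \<bar>real_of_int (a + 2 * fst p)\<bar> + \<bar>real_of_int (b + 2 * snd p)\<bar>"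
      unfolding taxicab_def by linarith
    hence "c * taxicab p \<le> c * (\<bar>real_of_int (a + 2 * fst p)\<bar> + \<bar>real_of_int (b + 2 * snd p)\<bar>)"
      using c by (intro mult_left_mono) auto
    also have "\<dots> \<le> norm (of_real (real_of_int (a + 2 * fst p)) + of_real (real_of_int (b + 2 * snd p)) * \<tau>)"
      unfolding c_def by (rule norm_real_combination_ge[OF assms(1-3)])
    also have "of_real (real_of_int (a + 2 * fst p)) + of_real (real_of_int (b + 2 * snd p)) * \<tau> =
        2 * (w / 2 + lattice_point \<tau> p)"
      unfolding w lattice_point_def by (simp add: algebra_simps)
    finally show ?thesis
      by (simp only: norm_mult) simp
  qed
  show "y0 / (y0 + R + 1) / 2 * taxicab p \<le> norm (w / 2 + lattice_point \<tau> p)"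
    using *[of p] by (simp add: c_def)
  have "lattice_point \<tau> (- fst p, - snd p) = - lattice_point \<tau> p" "taxicab (- fst p, - snd p) = taxicab p"
    by (simp_all add: lattice_point_def taxicab_def)
  thus "y0 / (y0 + R + 1) / 2 * taxicab p \<le> norm (w / 2 - lattice_point \<tau> p)"
    using *[of "(- fst p, - snd p)"] by (simp add: c_def)
qed

lemma lattice_point_eq_0_iff:
  assumes "\<tau> \<in> upper_half_plane"
  shows "lattice_point \<tau> p = 0 \<longleftrightarrow> p = (0, 0)"
  using assms by (cases p) (auto simp: lattice_point_def upper_half_plane_def complex_eq_iff)

lemma inj_lattice_point:
  assumes "\<tau> \<in> upper_half_plane"
  shows "inj (lattice_point \<tau>)"
proof (rule injI)
  fix p q assume "lattice_point \<tau> p = lattice_point \<tau> q"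
  hence "lattice_point \<tau> (fst p - fst q, snd p - snd q) = 0"
    by (simp add: lattice_point_def algebra_simps)
  thus "p = q"
    by (simp add: lattice_point_eq_0_iff[OF assms] prod_eq_iff)
qed

lemma zeta_lattice_upper_half_plane:
  assumes "\<tau> \<in> upper_half_plane"
  shows "zeta_lattice (lattice 1 \<tau>)"
proof
  show "0 \<in> lattice 1 \<tau>"
    by (auto simp: lattice_def intro: exI[of _ 0])
  show "x - y \<in> lattice 1 \<tau>" if "x \<in> lattice 1 \<tau>" "y \<in> lattice 1 \<tau>" for x y
  proof -
    obtain p q where "x = lattice_point \<tau> p" "y = lattice_point \<tau> q"
      using \<open>x \<in> lattice 1 \<tau>\<close> \<open>y \<in> lattice 1 \<tau>\<close> by (auto simp: lattice_eq_range)
    hence "x - y = lattice_point \<tau> (fst p - fst q, snd p - snd q)"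
      by (simp add: lattice_point_def algebra_simps)
    thus ?thesis
      by (simp add: lattice_eq_range)
  qed
  define c where "c = Im \<tau> / (Im \<tau> + norm \<tau> + 1)"
  have Im: "Im \<tau> > 0"
    using assms by (simp add: upper_half_plane_def)
  hence c: "c > 0"
    by (simp add: c_def add_pos_nonneg)
  have "(\<lambda>p. 1 / c ^ 3 * (1 / taxicab p ^ 3)) summable_on UNIV"
    by (intro summable_on_cmult_right summable_taxicab_cube)
  hence "(\<lambda>p. 1 / norm (lattice_point \<tau> p) ^ 3) summable_on UNIV"
  proof (rule summable_on_comparison_test)
    fix p :: "int \<times> int"
    show "1 / norm (lattice_point \<tau> p) ^ 3 \<le> 1 / c ^ 3 * (1 / taxicab p ^ 3)"
    proof (cases "p = (0, 0)")
      case False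
      have "(c * taxicab p) ^ 3 \<le> norm (lattice_point \<tau> p) ^ 3"
        unfolding c_def using c Im taxicab_ge_1[OF False] norm_lattice_point_ge[OF Im order_refl order_refl, of p]
        by (intro power_mono) (auto simp: c_def)
      moreover have "0 < (c * taxicab p) ^ 3"
        using c taxicab_ge_1[OF False] by simp
      ultimately show ?thesis
        by (simp add: power_mult_distrib frac_le)
    qed (simp add: lattice_point_def taxicab_def)
  qed auto
  thus "(\<lambda>\<omega>. 1 / norm \<omega> ^ 3) summable_on lattice 1 \<tau>"
    unfolding lattice_eq_range by (subst summable_on_reindex[OF inj_lattice_point[OF assms]]) (simp add: o_def)
qed

lemma one_in_lattice: "1 \<in> lattice 1 \<tau>" and tau_in_lattice: "\<tau> \<in> lattice 1 \<tau>"
proof -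
  have "1 = lattice_point \<tau> (1, 0)" "\<tau> = lattice_point \<tau> (0, 1)"
    by (simp_all add: lattice_point_def)
  thus "1 \<in> lattice 1 \<tau>" "\<tau> \<in> lattice 1 \<tau>"
    unfolding lattice_eq_range by (metis rangeI)+
qed

section \<open>Holomorphy of the quasi-periods in \<tau>\<close>

lemma eta_lattice_eq:
  assumes "\<tau> \<in> upper_half_plane" and "w \<in> lattice 1 \<tau>"
  shows "eta (lattice 1 \<tau>) w = (\<Sum>\<^sub>\<infinity>p. eta_term w (lattice_point \<tau> p))"
    and "(\<lambda>p. eta_term w (lattice_point \<tau> p)) summable_on UNIV"
proof -
  interpret zeta_lattice "lattice 1 \<tau>"
    by (rule zeta_lattice_upper_half_plane) fact
  show "eta (lattice 1 \<tau>) w = (\<Sum>\<^sub>\<infinity>p. eta_term w (lattice_point \<tau> p))"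
    unfolding eta_eq[OF assms(2)] unfolding lattice_eq_range
    by (subst infsum_reindex[OF inj_lattice_point[OF assms(1)]]) (simp add: o_def)
  show "(\<lambda>p. eta_term w (lattice_point \<tau> p)) summable_on UNIV"
    using summable_eta_term[of w] unfolding lattice_eq_range
    by (subst (asm) summable_on_reindex[OF inj_lattice_point[OF assms(1)]]) (simp add: o_def)
qed

text \<open>Uniform convergence along the filter of finite index sets already gives a holomorphic
  limit, so the index set is never enumerated. The majorant may change from disc to disc.\<close>

lemma holomorphic_on_infsum:
  fixes f :: "'a \<Rightarrow> complex \<Rightarrow> complex"
  assumes "open A" and holo: "\<And>i. i \<in> I \<Longrightarrow> f i holomorphic_on A"
    and bound: "\<And>z. z \<in> A \<Longrightarrow> \<exists>r>0. \<exists>M. M summable_on I \<and> (\<forall>i\<in>I. \<forall>w\<in>cball z r \<inter> A. norm (f i w) \<le> M i)"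
  shows "(\<lambda>z. \<Sum>\<^sub>\<infinity>i\<in>I. f i z) holomorphic_on A"
proof (rule analytic_imp_holomorphic, unfold analytic_on_def, rule ballI)
  fix z assume z: "z \<in> A"
  obtain r M where r: "r > 0" "M summable_on I" "\<forall>i\<in>I. \<forall>w\<in>cball z r \<inter> A. norm (f i w) \<le> M i"
    using bound[OF z] by (elim exE conjE)
  obtain r' where r': "r' > 0" "cball z r' \<subseteq> A"
    using \<open>open A\<close> z open_contains_cball[of A] by blast
  define s where "s = min r r'"
  have s: "s > 0" "cball z s \<subseteq> cball z r \<inter> A"
    using r r' by (auto simp: s_def)
  have ul: "uniform_limit (cball z s) (\<lambda>X w. \<Sum>i\<in>X. f i w) (\<lambda>w. \<Sum>\<^sub>\<infinity>i\<in>I. f i w) (finite_subsets_at_top I)"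
    by (rule Weierstrass_m_test_general[where M = M]) (use r s(2) in blast)+
  have ev: "\<forall>\<^sub>F X in finite_subsets_at_top I.
      continuous_on (cball z s) (\<lambda>w. \<Sum>i\<in>X. f i w) \<and> (\<lambda>w. \<Sum>i\<in>X. f i w) holomorphic_on ball z s"
  proof (rule eventually_finite_subsets_at_top_weakI)
    fix X assume "finite X" "X \<subseteq> I"
    hence "(\<lambda>w. \<Sum>i\<in>X. f i w) holomorphic_on cball z s"
      using s by (intro holomorphic_on_sum holomorphic_on_subset[OF holo]) auto
    thus "continuous_on (cball z s) (\<lambda>w. \<Sum>i\<in>X. f i w) \<and> (\<lambda>w. \<Sum>i\<in>X. f i w) holomorphic_on ball z s"
      using holomorphic_on_imp_continuous_on holomorphic_on_subset ball_subset_cball by blast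
  qed
  have "(\<lambda>w. \<Sum>\<^sub>\<infinity>i\<in>I. f i w) holomorphic_on ball z s"
    using holomorphic_uniform_limit[OF ev ul] by auto
  thus "\<exists>e>0. (\<lambda>w. \<Sum>\<^sub>\<infinity>i\<in>I. f i w) holomorphic_on ball z e"
    using s by blast
qed

lemma half_period_not_in_lattice:
  assumes "\<tau> \<in> upper_half_plane" and "w = 1 \<or> w = \<tau>"
  shows "w / 2 + lattice_point \<tau> p \<noteq> 0" and "w / 2 - lattice_point \<tau> p \<noteq> 0"
proof -
  have Im: "Im \<tau> > 0"
    using assms(1) by (simp add: upper_half_plane_def)
  have "w / 2 + lattice_point \<tau> p \<noteq> 0 \<and> w / 2 - lattice_point \<tau> p \<noteq> 0"
  proof (cases "p = (0, 0)")
    case True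
    moreover have "w \<noteq> 0"
      using assms(2) Im by auto
    ultimately show ?thesis
      by (simp add: lattice_point_def)
  next
    case False
    have "0 < Im \<tau> / (Im \<tau> + norm \<tau> + 1) / 2 * taxicab p"
      using Im taxicab_ge_1[OF False] by (simp add: add_pos_nonneg)
    thus ?thesis
      using norm_half_period_shift_ge[OF Im order_refl order_refl assms(2), of p] by auto
  qed
  thus "w / 2 + lattice_point \<tau> p \<noteq> 0" "w / 2 - lattice_point \<tau> p \<noteq> 0"
    by simp_all
qed

text \<open>Over a common denominator everything below degree three in w cancels, which exhibits the
  decay of order |\<omega>|^-4.\<close>

lemma eta_term_eq:
  assumes "\<omega> \<noteq> 0" and "w / 2 - \<omega> \<noteq> 0" and "w / 2 + \<omega> \<noteq> 0"
  shows "eta_term w \<omega> = w ^ 3 / (4 * (\<omega>\<^sup>2 * ((w / 2 - \<omega>) * (w / 2 + \<omega>))))"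
proof -
  have "1 / (a - \<omega>) + 1 / (a + \<omega>) + 2 * a / \<omega>\<^sup>2 = 2 * a ^ 3 / (\<omega>\<^sup>2 * ((a - \<omega>) * (a + \<omega>)))"
    if "a - \<omega> \<noteq> 0" "a + \<omega> \<noteq> 0" for a
    using that assms(1) by (simp add: divide_simps) (simp add: algebra_simps power2_eq_square power3_eq_cube)
  from this[of "w / 2"] show ?thesis
    using assms(2,3) by (simp add: eta_term_def power_divide)
qed

text \<open>At p = (0, 0) division by zero leaves 4 / w, of norm 4 for w = 1 and at most 4 / y0 for
  w = \<tau>; the last summand accounts for it. Elsewhere R + 1 bounds |w| in both cases.\<close>

lemma norm_eta_term_le:
  assumes "0 < y0" and "y0 \<le> Im \<tau>" and "norm \<tau> \<le> R" and "w = 1 \<or> w = \<tau>"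
  shows "norm (eta_term w (lattice_point \<tau> p)) \<le>
    (R + 1) ^ 3 / (y0 / (y0 + R + 1)) ^ 4 * (1 / taxicab p ^ 3) + (if p = (0, 0) then 4 + 4 / y0 else 0)"
proof (cases "p = (0, 0)")
  case True
  have "eta_term w 0 = 4 / w"
    by (simp add: eta_term_def)
  moreover have "4 / norm \<tau> \<le> 4 / y0"
    using assms(1,2) abs_Im_le_cmod[of \<tau>] by (intro frac_le) auto
  ultimately have "norm (eta_term w 0) \<le> 4 + 4 / y0"
    using assms(1,4) by (auto simp: norm_divide)
  with True show ?thesis
    by (simp add: lattice_point_def taxicab_def)
next
  case False
  define c T \<omega> where "c = y0 / (y0 + R + 1)" and "T = taxicab p" and "\<omega> = lattice_point \<tau> p"
  have R: "R \<ge> 0"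
    using assms(3) norm_ge_zero order_trans by blast
  have c: "c > 0" and T: "T \<ge> 1"
    using assms(1) R taxicab_ge_1[OF False] by (simp_all add: c_def T_def)
  have \<tau>: "\<tau> \<in> upper_half_plane"
    using assms(1,2) by (simp add: upper_half_plane_def)
  have ge: "c * T \<le> norm \<omega>" "c / 2 * T \<le> norm (w / 2 - \<omega>)" "c / 2 * T \<le> norm (w / 2 + \<omega>)"
    unfolding c_def T_def \<omega>_def
    using norm_lattice_point_ge[OF assms(1-3)] norm_half_period_shift_ge[OF assms] by blast+
  have cT: "c * T > 0"
    using c T by simp
  have nz: "\<omega> \<noteq> 0" "w / 2 - \<omega> \<noteq> 0" "w / 2 + \<omega> \<noteq> 0"
    using False lattice_point_eq_0_iff[OF \<tau>] half_period_not_in_lattice[OF \<tau> assms(4)]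
    by (auto simp: \<omega>_def)
  have "norm (eta_term w \<omega>) =
      norm w ^ 3 / (4 * (norm \<omega> ^ 2 * (norm (w / 2 - \<omega>) * norm (w / 2 + \<omega>))))"
    using nz by (simp add: eta_term_eq norm_divide norm_mult norm_power)
  also have "\<dots> \<le> (R + 1) ^ 3 / (4 * ((c * T) ^ 2 * ((c / 2 * T) * (c / 2 * T))))"
  proof (rule frac_le)
    show "norm w ^ 3 \<le> (R + 1) ^ 3"
      using assms(3,4) R by (intro power_mono) auto
    show "4 * ((c * T) ^ 2 * ((c / 2 * T) * (c / 2 * T))) \<le>
        4 * (norm \<omega> ^ 2 * (norm (w / 2 - \<omega>) * norm (w / 2 + \<omega>)))"
      using ge cT by (intro mult_left_mono mult_mono power_mono) auto
  qed (use c T R in auto)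
  \<comment> \<open>The two factors c / 2 cancel the 4 of \<open>eta_term_eq\<close>.\<close>
  also have "\<dots> = (R + 1) ^ 3 / c ^ 4 * (1 / T ^ 4)"
    using c T by (simp add: field_simps power2_eq_square eval_nat_numeral)
  \<comment> \<open>One power of T \<ge> 1 is given away so that the summable cubes can be
    reused.\<close>
  also have "\<dots> \<le> (R + 1) ^ 3 / c ^ 4 * (1 / T ^ 3)"
    using c T R by (intro mult_left_mono divide_left_mono power_increasing) auto
  finally show ?thesis
    using False by (simp add: c_def T_def \<omega>_def)
qed

lemma open_upper_half_plane: "open upper_half_plane"
  unfolding upper_half_plane_def by (rule open_halfspace_Im_gt)

lemma connected_upper_half_plane: "connected upper_half_plane"
  unfolding upper_half_plane_def by (intro convex_connected convex_halfspace_Im_gt)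

lemma holomorphic_eta_period:
  assumes "\<And>\<tau>. w \<tau> = 1 \<or> w \<tau> = \<tau>" and "w holomorphic_on upper_half_plane"
  shows "(\<lambda>\<tau>. eta (lattice 1 \<tau>) (w \<tau>)) holomorphic_on upper_half_plane"
proof -
  have "(\<lambda>\<tau>. \<Sum>\<^sub>\<infinity>p. eta_term (w \<tau>) (lattice_point \<tau> p)) holomorphic_on upper_half_plane"
  proof (rule holomorphic_on_infsum)
    fix p :: "int \<times> int"
    show "(\<lambda>\<tau>. eta_term (w \<tau>) (lattice_point \<tau> p)) holomorphic_on upper_half_plane"
    proof (cases "p = (0, 0)")
      case True
      have "w \<tau> \<noteq> 0" if "\<tau> \<in> upper_half_plane" for \<tau>
        using assms(1)[of \<tau>] that by (auto simp: upper_half_plane_def)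
      hence "(\<lambda>\<tau>. 4 / w \<tau>) holomorphic_on upper_half_plane"
        by (intro holomorphic_intros assms(2)) auto
      with True show ?thesis
        by (simp add: lattice_point_def eta_term_def)
    next
      case False
      have "(\<lambda>\<tau>. lattice_point \<tau> p) holomorphic_on upper_half_plane"
        unfolding lattice_point_def by (intro holomorphic_intros)
      thus ?thesis
        unfolding eta_term_def
        using assms False half_period_not_in_lattice lattice_point_eq_0_iff
        by (intro holomorphic_intros) auto
    qed
  next
    fix \<tau>0 assume \<tau>0: "\<tau>0 \<in> upper_half_plane"
    \<comment> \<open>Half the height of \<tau>0 as radius keeps the disc above height y0, and R
      bounds |\<tau>| on it.\<close>
    define y0 R where "y0 = Im \<tau>0 / 2" and "R = norm \<tau>0 + y0"
    have y0: "y0 > 0"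
      using \<tau>0 by (simp add: y0_def upper_half_plane_def)
    define M where "M = (\<lambda>p. (R + 1) ^ 3 / (y0 / (y0 + R + 1)) ^ 4 * (1 / taxicab p ^ 3) +
      (if p = (0, 0) then 4 + 4 / y0 else 0))"
    have "M summable_on UNIV"
      unfolding M_def
      by (intro summable_on_add summable_on_cmult_right summable_taxicab_cube
            finite_nonzero_values_imp_summable_on) auto
    moreover have "norm (eta_term (w \<tau>) (lattice_point \<tau> p)) \<le> M p" if "\<tau> \<in> cball \<tau>0 y0" for \<tau> p
      unfolding M_def
    proof (rule norm_eta_term_le[OF y0 _ _ assms(1)])
      have "norm (\<tau> - \<tau>0) \<le> y0"
        using that by (simp add: dist_norm norm_minus_commute)
      thus "y0 \<le> Im \<tau>" "norm \<tau> \<le> R"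
        using abs_Im_le_cmod[of "\<tau> - \<tau>0"] norm_triangle_ineq2[of \<tau> \<tau>0] by (auto simp: y0_def R_def)
    qed
    ultimately show "\<exists>r>0. \<exists>M. M summable_on UNIV \<and>
        (\<forall>p\<in>UNIV. \<forall>\<tau>\<in>cball \<tau>0 r \<inter> upper_half_plane. norm (eta_term (w \<tau>) (lattice_point \<tau> p)) \<le> M p)"
      using y0 by blast
  qed (rule open_upper_half_plane)
  moreover have "w \<tau> \<in> lattice 1 \<tau>" for \<tau>
    using assms(1)[of \<tau>] one_in_lattice[of \<tau>] tau_in_lattice[of \<tau>] by auto
  ultimately show ?thesis
    by (subst holomorphic_cong[OF refl eta_lattice_eq(1)]) auto
qed

section \<open>Invertibility of the period matrix\<close>

lemma sum_telescope_int:
  fixes f :: "int \<Rightarrow> 'a :: ab_group_add"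
  shows "(\<Sum>m\<in>{- int n..int n}. f (m + 1) - f m) = f (int n + 1) - f (- int n)"
proof (induction n)
  case (Suc n)
  have "{- int (Suc n)..int (Suc n)} = insert (- 1 - int n) (insert (1 + int n) {- int n..int n})"
    by auto
  thus ?case
    using Suc by (simp add: algebra_simps)
qed simp

text \<open>A partial sum of the partial fraction expansion of pi * cot(pi * y), which tends to - pi
  * \<i> as Im y grows. The symmetric range makes it odd.\<close>

definition cot_sum :: "nat \<Rightarrow> complex \<Rightarrow> complex" where
  "cot_sum M y = (\<Sum>m\<in>{- int M..int M}. 1 / (y + of_int m))"

lemma cot_sum_uminus: "cot_sum M (- y) = - cot_sum M y"
proof -
  have "cot_sum M (- y) = (\<Sum>m\<in>{- int M..int M}. 1 / (- y + of_int (- m)))"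
    unfolding cot_sum_def by (rule sum.reindex_bij_witness[of _ uminus uminus]) auto
  also have "\<dots> = (\<Sum>m\<in>{- int M..int M}. - (1 / (y + of_int m)))"
  proof (intro sum.cong refl)
    fix m
    have "- y + of_int (- m) = - (y + of_int m)"
      by simp
    thus "1 / (- y + of_int (- m)) = - (1 / (y + of_int m))"
      by (simp only: minus_divide_right)
  qed
  finally show ?thesis
    by (simp add: cot_sum_def sum_negf)
qed

text \<open>About \<open>Im y\<close> of the terms, those with \<open>0 \<le> Re y + m < Im y\<close>, are each at least of order
  \<open>1 / Im y\<close>.\<close>

lemma Im_cot_sum_le:
  assumes "1 \<le> Im y" and "\<bar>Re y\<bar> + Im y + 1 \<le> real M"
  shows "Im (cot_sum M y) \<le> - 1 / 4"
proof -
  define m0 where "m0 = \<lceil>- Re y\<rceil>"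
  define k where "k = \<lfloor>Im y\<rfloor>"
  have Im: "Im (1 / (y + of_int m)) = - (Im y / ((Re y + of_int m)\<^sup>2 + (Im y)\<^sup>2))" for m
    by (simp add: Im_divide)
  \<comment> \<open>The window starts at the least m with Re y + m \<ge> 0; the lower bound on M
    leaves room for its k integers.\<close>
  have sub: "{m0..<m0 + k} \<subseteq> {- int M..int M}"
    using assms unfolding m0_def k_def by auto linarith+
  \<comment> \<open>Since k = \<lfloor>Im y\<rfloor> \<ge> 1, also 2 * k \<ge> k + 1 > Im y. At
    least Im y / 2 terms of size at least 1 / (2 * Im y) give the bound 1/4.\<close>
  have "k \<ge> 1" "real_of_int k > Im y - 1"
    using assms(1) by (simp_all add: k_def le_floor_iff)
  hence "Im y \<le> 2 * real_of_int k"
    by linarith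
  hence "1 / 4 \<le> real_of_int k * (1 / (2 * Im y))"
    using assms(1) by (simp add: field_simps)
  also have "\<dots> = (\<Sum>m\<in>{m0..<m0 + k}. 1 / (2 * Im y))"
    using assms(1) by (simp add: k_def)
  also have "\<dots> \<le> (\<Sum>m\<in>{m0..<m0 + k}. Im y / ((Re y + of_int m)\<^sup>2 + (Im y)\<^sup>2))"
  proof (rule sum_mono)
    fix m assume m: "m \<in> {m0..<m0 + k}"
    have "0 \<le> Re y + of_int m" "Re y + of_int m \<le> Im y"
      using m unfolding m0_def k_def by auto linarith+
    hence "(Re y + of_int m)\<^sup>2 \<le> (Im y)\<^sup>2"
      by (intro power_mono)
    hence "Im y / (2 * (Im y)\<^sup>2) \<le> Im y / ((Re y + of_int m)\<^sup>2 + (Im y)\<^sup>2)"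
      using assms(1) by (intro divide_left_mono) (auto intro!: mult_pos_pos add_nonneg_pos)
    thus "1 / (2 * Im y) \<le> Im y / ((Re y + of_int m)\<^sup>2 + (Im y)\<^sup>2)"
      using assms(1) by (simp add: power2_eq_square)
  qed
  also have "\<dots> \<le> (\<Sum>m\<in>{- int M..int M}. Im y / ((Re y + of_int m)\<^sup>2 + (Im y)\<^sup>2))"
    using sub assms(1) by (intro sum_mono2) auto
  also have "\<dots> = - Im (cot_sum M y)"
    unfolding cot_sum_def Im_sum Im by (simp add: sum_negf)
  finally show ?thesis
    by simp
qed

lemma tendsto_inverse_shift_0:
  fixes z :: complex
  shows "(\<lambda>M. 1 / (of_nat M + z)) \<longlonglongrightarrow> 0" and "(\<lambda>M. 1 / (z - of_nat M)) \<longlonglongrightarrow> 0"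
proof -
  have "filterlim (\<lambda>M. of_nat M + z) at_infinity sequentially" for z :: complex
    by (rule tendsto_add_filterlim_at_infinity') (auto intro: tendsto_of_nat)
  thus 1: "(\<lambda>M. 1 / (of_nat M + z)) \<longlonglongrightarrow> 0" for z :: complex
    by (intro tendsto_divide_0[OF tendsto_const])
  have "(\<lambda>M. - (1 / (of_nat M + (- z)))) \<longlonglongrightarrow> - 0"
    by (intro tendsto_minus 1)
  moreover have "- (1 / (of_nat M + (- z))) = 1 / (z - of_nat M)" for M
    by (metis minus_diff_eq minus_divide_right uminus_add_conv_diff add.commute)
  ultimately show "(\<lambda>M. 1 / (z - of_nat M)) \<longlonglongrightarrow> 0"
    by simp
qed

text \<open>By Legendre's relation the left-hand side is \<open>2 \<pi> \<i>\<close>. Both of its halves telescope over a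
  centred rectangle: the first in \<open>m\<close>, leaving terms that vanish as \<open>M \<rightarrow> \<infinity>\<close>, and the second in \<open>n\<close>,
  leaving a cotangent sum far from the real axis.\<close>

lemma legendre_nonzero:
  assumes "\<tau> \<in> upper_half_plane"
  shows "\<tau> * eta (lattice 1 \<tau>) 1 - eta (lattice 1 \<tau>) \<tau> \<noteq> 0"
proof -
  define D where "D = \<tau> * eta (lattice 1 \<tau>) 1 - eta (lattice 1 \<tau>) \<tau>"
  define e where "e = (\<lambda>p. \<tau> * eta_term 1 (lattice_point \<tau> p) - eta_term \<tau> (lattice_point \<tau> p))"
  define a where "a = (\<lambda>n m. 1 / (of_int m + (of_int n * \<tau> - 1 / 2)))"
  define b where "b = (\<lambda>M n. cot_sum M ((of_int n - 1 / 2) * \<tau>))"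
  have Im: "Im \<tau> > 0"
    using assms by (simp add: upper_half_plane_def)
  have "(e has_sum (\<tau> * (\<Sum>\<^sub>\<infinity>p. eta_term 1 (lattice_point \<tau> p)) -
      (\<Sum>\<^sub>\<infinity>p. eta_term \<tau> (lattice_point \<tau> p)))) UNIV"
    unfolding e_def diff_conv_add_uminus
    by (intro has_sum_add has_sum_cmult_right has_sum_uminusI has_sum_infsum eta_lattice_eq(2)[OF assms]
          one_in_lattice tau_in_lattice)
  hence e_sum: "(e has_sum D) UNIV"
    by (simp add: D_def eta_lattice_eq(1)[OF assms] one_in_lattice tau_in_lattice)
  \<comment> \<open>The compensators cancel, as \<tau> * (1 / \<omega>^2) - \<tau> / \<omega>^2 = 0.
    What is left is \<tau> times a difference in m, taken half a step off the integers, minus a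
    difference in n, taken half a step off the multiples of \<tau>.\<close>
  have e_eq: "e (m, n) = \<tau> * (a n (m + 1) - a n m) -
      (1 / ((of_int (n + 1) - 1 / 2) * \<tau> + of_int m) - 1 / ((of_int n - 1 / 2) * \<tau> + of_int m))" for m n
  proof -
    have neg: "1 / (x - y) = - (1 / (y - x))" for x y :: complex
      by (metis minus_diff_eq minus_divide_right)
    have "e (m, n) = \<tau> * (1 / (1 / 2 - (of_int m + of_int n * \<tau>)) + 1 / (1 / 2 + (of_int m + of_int n * \<tau>))) -
        (1 / (\<tau> / 2 - (of_int m + of_int n * \<tau>)) + 1 / (\<tau> / 2 + (of_int m + of_int n * \<tau>)))"
      by (simp add: e_def eta_term_def lattice_point_def distrib_left)
    also have "1 / (1 / 2 - (of_int m + of_int n * \<tau>)) = - a n m"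
      unfolding a_def by (subst neg) (simp add: algebra_simps)
    also have "1 / (1 / 2 + (of_int m + of_int n * \<tau>)) = a n (m + 1)"
      unfolding a_def by (simp add: algebra_simps)
    also have "1 / (\<tau> / 2 - (of_int m + of_int n * \<tau>)) = - (1 / ((of_int n - 1 / 2) * \<tau> + of_int m))"
      by (subst neg) (simp add: algebra_simps)
    also have "\<tau> / 2 + (of_int m + of_int n * \<tau>) = (of_int (n + 1) - 1 / 2) * \<tau> + of_int m"
      by (simp add: algebra_simps)
    finally show ?thesis
      by simp
  qed
  \<comment> \<open>In n the telescoping ends at N + 1 and - N, whose arguments (N + 1/2) * \<tau>
    and - (N + 1/2) * \<tau> are opposite; oddness of \<open>cot_sum\<close> produces the factor
    2.\<close>
  have rect: "(\<Sum>p\<in>{- int M..int M} \<times> {- int N..int N}. e p) =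
      \<tau> * (\<Sum>n\<in>{- int N..int N}. a n (int M + 1) - a n (- int M)) -
      2 * cot_sum M ((of_nat N + 1 / 2) * \<tau>)" for M N
  proof -
    have "(\<Sum>p\<in>{- int M..int M} \<times> {- int N..int N}. e p) =
        (\<Sum>n\<in>{- int N..int N}. \<Sum>m\<in>{- int M..int M}. e (m, n))"
      by (subst sum.swap) (simp add: sum.cartesian_product)
    also have "\<dots> = (\<Sum>n\<in>{- int N..int N}. \<tau> * (a n (int M + 1) - a n (- int M)) - (b M (n + 1) - b M n))"
      unfolding e_eq sum_subtractf sum_distrib_left[symmetric] b_def cot_sum_def
      by (simp flip: sum_subtractf add: sum_telescope_int)
    also have "\<dots> = \<tau> * (\<Sum>n\<in>{- int N..int N}. a n (int M + 1) - a n (- int M)) - (b M (int N + 1) - b M (- int N))"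
      by (simp only: sum_subtractf[of "\<lambda>n. \<tau> * _ n"] sum_telescope_int sum_distrib_left)
    also have "b M (int N + 1) = cot_sum M ((of_nat N + 1 / 2) * \<tau>)"
      by (simp add: b_def algebra_simps)
    also have "b M (- int N) = cot_sum M (- ((of_nat N + 1 / 2) * \<tau>))"
      by (simp add: b_def algebra_simps)
    finally show ?thesis
      by (simp add: cot_sum_uminus)
  qed
  \<comment> \<open>Convergence is unconditional, so every finite set containing X0 may be used, in
    particular rectangles of any proportions.\<close>
  have "\<forall>\<^sub>F X in finite_subsets_at_top UNIV. dist (sum e X) D < 1 / 8"
    using e_sum unfolding has_sum_def by (rule tendstoD) simp
  then obtain X0 where X0: "finite X0" "\<And>X. finite X \<Longrightarrow> X0 \<subseteq> X \<Longrightarrow> dist (sum e X) D < 1 / 8"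
    unfolding eventually_finite_subsets_at_top by auto
  define B where "B = nat (Max (insert 0 ((\<lambda>p. max \<bar>fst p\<bar> \<bar>snd p\<bar>) ` X0)))"
  have B: "\<bar>fst p\<bar> \<le> int B \<and> \<bar>snd p\<bar> \<le> int B" if "p \<in> X0" for p
  proof -
    have "max \<bar>fst p\<bar> \<bar>snd p\<bar> \<le> Max (insert 0 ((\<lambda>p. max \<bar>fst p\<bar> \<bar>snd p\<bar>) ` X0))"
      using X0(1) that by (intro Max_ge) auto
    thus ?thesis
      by (auto simp: B_def)
  qed
  have B': "X0 \<subseteq> {- int M..int M} \<times> {- int N..int N}" if "M \<ge> B" "N \<ge> B" for M N
    using B that by (fastforce simp: mem_Times_iff)
  \<comment> \<open>The height is fixed first: both the decay of the boundary terms for large M and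
    the width that the cotangent bound demands depend on it.\<close>
  obtain N where N: "N \<ge> B" "(real N + 1 / 2) * Im \<tau> \<ge> 1"
  proof -
    obtain n where n: "real n \<ge> 1 / Im \<tau>"
      using real_arch_simple by blast
    have "1 / Im \<tau> \<le> real (max B n) + 1 / 2"
      using n by linarith
    hence "1 \<le> (real (max B n) + 1 / 2) * Im \<tau>"
      using Im by (simp add: field_simps)
    thus ?thesis
      by (intro that[of "max B n"]) auto
  qed
  define y where "y = (of_nat N + 1 / 2) * \<tau>"
  have y: "Im y \<ge> 1"
    using N(2) by (simp add: y_def)
  have "(\<lambda>M. a n (int M + 1) - a n (- int M)) \<longlonglongrightarrow> 0 - 0" for n
  proof (rule tendsto_diff)
    show "(\<lambda>M. a n (int M + 1)) \<longlonglongrightarrow> 0"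
      using tendsto_inverse_shift_0(1)[of "1 + (of_int n * \<tau> - 1 / 2)"] by (simp add: a_def add_ac)
    show "(\<lambda>M. a n (- int M)) \<longlonglongrightarrow> 0"
      using tendsto_inverse_shift_0(2)[of "of_int n * \<tau> - 1 / 2"] by (simp add: a_def algebra_simps)
  qed
  hence "(\<lambda>M. \<tau> * (\<Sum>n\<in>{- int N..int N}. a n (int M + 1) - a n (- int M))) \<longlonglongrightarrow>
      \<tau> * (\<Sum>n\<in>{- int N..int N}. 0 - 0)"
    by (intro tendsto_mult tendsto_const tendsto_sum)
  hence lim: "(\<lambda>M. \<tau> * (\<Sum>n\<in>{- int N..int N}. a n (int M + 1) - a n (- int M))) \<longlonglongrightarrow> 0"
    by simp
  have "\<forall>\<^sub>F M in sequentially. norm (\<tau> * (\<Sum>n\<in>{- int N..int N}. a n (int M + 1) - a n (- int M))) < 1 / 8"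
    using tendstoD[OF lim, of "1 / 8"] by (simp add: dist_norm)
  moreover have "\<forall>\<^sub>F M in sequentially. M \<ge> B \<and> \<bar>Re y\<bar> + Im y + 1 \<le> real M"
    using eventually_ge_at_top[of B] eventually_ge_at_top[of "nat \<lceil>\<bar>Re y\<bar> + Im y + 1\<rceil>"]
    by eventually_elim linarith
  ultimately have "\<forall>\<^sub>F M in sequentially. M \<ge> B \<and> \<bar>Re y\<bar> + Im y + 1 \<le> real M \<and>
      norm (\<tau> * (\<Sum>n\<in>{- int N..int N}. a n (int M + 1) - a n (- int M))) < 1 / 8"
    by eventually_elim auto
  then obtain M where M: "M \<ge> B" "\<bar>Re y\<bar> + Im y + 1 \<le> real M"
    "norm (\<tau> * (\<Sum>n\<in>{- int N..int N}. a n (int M + 1) - a n (- int M))) < 1 / 8"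
    using eventually_happens[of _ sequentially] by auto
  define S A where "S = (\<Sum>p\<in>{- int M..int M} \<times> {- int N..int N}. e p)"
    and "A = \<tau> * (\<Sum>n\<in>{- int N..int N}. a n (int M + 1) - a n (- int M))"
  have "norm (S - D) < 1 / 8"
    using X0(2)[OF _ B'[OF M(1) N(1)]] by (simp add: S_def dist_norm)
  moreover have "S = A - 2 * cot_sum M y"
    unfolding S_def A_def y_def by (rule rect)
  \<comment> \<open>The error budget is Im D > - 1/8 + 2 * (1/4) - 1/8 = 1/4.\<close>
  ultimately have "\<bar>Im A - 2 * Im (cot_sum M y) - Im D\<bar> < 1 / 8"
    using abs_Im_le_cmod[of "S - D"] by simp
  moreover have "\<bar>Im A\<bar> < 1 / 8"
    using M(3) abs_Im_le_cmod[of A] by (simp add: A_def)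
  moreover have "Im (cot_sum M y) \<le> - 1 / 4"
    by (rule Im_cot_sum_le[OF y M(2)])
  ultimately have "Im D > 0"
    by linarith
  hence "D \<noteq> 0"
    by auto
  thus ?thesis
    by (simp add: D_def)
qed

section \<open>The action of the modular group\<close>

lemma SL2Z_simps [simp]:
  "carrier SL2Z = {A. det A = 1}" "monoid.mult SL2Z = (**)" "one SL2Z = mat 1"
  by (simp_all add: SL2Z_def)

lemma group_SL2Z: "group SL2Z"
proof (rule groupI)
  fix A :: "int^2^2" assume "A \<in> carrier SL2Z"
  hence det: "A$1$1 * A$2$2 - A$1$2 * A$2$1 = 1"
    by (simp add: det_2)
  define B :: "int^2^2" where "B = vector [vector [A$2$2, - A$1$2], vector [- A$2$1, A$1$1]]"
  have "B ** A = mat 1" "det B = 1"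
    using det unfolding B_def
    by (auto simp: vec_eq_iff forall_2 matrix_matrix_mult_def sum_2 vector_2 mat_def det_2 algebra_simps)
  thus "\<exists>B\<in>carrier SL2Z. B \<otimes>\<^bsub>SL2Z\<^esub> A = \<one>\<^bsub>SL2Z\<^esub>"
    by (auto intro!: bexI[of _ B])
qed (auto simp: det_mul matrix_mul_assoc)

definition cocycle :: "int^2^2 \<Rightarrow> complex \<Rightarrow> complex" where
  "cocycle \<gamma> \<tau> = of_int (\<gamma>$2$1) * \<tau> + of_int (\<gamma>$2$2)"

lemma mat_moebius_eq: "mat_moebius \<gamma> \<tau> = (of_int (\<gamma>$1$1) * \<tau> + of_int (\<gamma>$1$2)) / cocycle \<gamma> \<tau>"
  by (simp add: mat_moebius_def moebius_def cocycle_def)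

lemma of_int_det_2:
  fixes \<gamma> :: "int^2^2"
  assumes "det \<gamma> = 1"
  shows "of_int (\<gamma>$1$1) * of_int (\<gamma>$2$2) - of_int (\<gamma>$1$2) * of_int (\<gamma>$2$1) = (1 :: 'a :: ring_1)"
  using arg_cong[OF assms, of "of_int :: int \<Rightarrow> 'a"] by (simp add: det_2)

lemma cocycle_nonzero:
  assumes "det \<gamma> = 1" and "\<tau> \<in> upper_half_plane"
  shows "cocycle \<gamma> \<tau> \<noteq> 0"
proof
  assume *: "cocycle \<gamma> \<tau> = 0"
  hence "Im (cocycle \<gamma> \<tau>) = 0"
    by simp
  hence "\<gamma>$2$1 = 0"
    using assms(2) by (simp add: cocycle_def upper_half_plane_def)
  with * have "\<gamma>$2$2 = 0"
    by (simp add: cocycle_def)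
  with \<open>\<gamma>$2$1 = 0\<close> show False
    using assms(1) by (simp add: det_2)
qed

lemma cocycle_mult_mat_moebius:
  assumes "det \<gamma> = 1" and "\<tau> \<in> upper_half_plane"
  shows "cocycle \<gamma> \<tau> * mat_moebius \<gamma> \<tau> = of_int (\<gamma>$1$1) * \<tau> + of_int (\<gamma>$1$2)"
  using cocycle_nonzero[OF assms] by (simp add: mat_moebius_eq)

lemma mat_moebius_upper_half_plane:
  assumes "det \<gamma> = 1" and "\<tau> \<in> upper_half_plane"
  shows "mat_moebius \<gamma> \<tau> \<in> upper_half_plane"
proof -
  define a b c d where "a = real_of_int (\<gamma>$1$1)" and "b = real_of_int (\<gamma>$1$2)"
    and "c = real_of_int (\<gamma>$2$1)" and "d = real_of_int (\<gamma>$2$2)"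
  have "a * d - b * c = 1"
    using of_int_det_2[OF assms(1), where 'a = real] by (simp add: a_def b_def c_def d_def)
  moreover have "a * Im \<tau> * (c * Re \<tau> + d) - (a * Re \<tau> + b) * (c * Im \<tau>) = (a * d - b * c) * Im \<tau>"
    by (simp add: algebra_simps)
  ultimately have "Im \<tau> = a * Im \<tau> * (c * Re \<tau> + d) - (a * Re \<tau> + b) * (c * Im \<tau>)"
    by simp
  also have "\<dots> / (cmod (cocycle \<gamma> \<tau>))\<^sup>2 = Im (mat_moebius \<gamma> \<tau>)"
    by (simp add: mat_moebius_eq Im_divide cocycle_def a_def b_def c_def d_def cmod_power2)
  finally have "Im (mat_moebius \<gamma> \<tau>) = Im \<tau> / (cmod (cocycle \<gamma> \<tau>))\<^sup>2" ..
  thus ?thesis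
    using assms(2) cocycle_nonzero[OF assms] by (simp add: upper_half_plane_def)
qed

text \<open>Injectivity, read off the inverse matrix, keeps the image of a punctured neighbourhood
  away from the image point. Hence limits and eventual statements at the image point can be pulled
  back to \<tau>.\<close>

lemma filterlim_mat_moebius:
  assumes "det \<gamma> = 1" and "\<tau> \<in> upper_half_plane"
  shows "filterlim (mat_moebius \<gamma>) (at (mat_moebius \<gamma> \<tau>)) (at \<tau>)"
proof (rule filterlim_atI)
  have "(\<lambda>z. (of_int (\<gamma>$1$1) * z + of_int (\<gamma>$1$2)) / cocycle \<gamma> z) \<midarrow>\<tau>\<rightarrow> mat_moebius \<gamma> \<tau>"
    unfolding mat_moebius_eq cocycle_def
    using cocycle_nonzero[OF assms] by (intro tendsto_intros) (simp add: cocycle_def)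
  thus "mat_moebius \<gamma> \<midarrow>\<tau>\<rightarrow> mat_moebius \<gamma> \<tau>"
    by (simp add: mat_moebius_eq[abs_def])
  have "\<forall>\<^sub>F z in at \<tau>. z \<in> upper_half_plane - {\<tau>}"
    by (intro eventually_at_in_open open_upper_half_plane assms)
  thus "\<forall>\<^sub>F z in at \<tau>. mat_moebius \<gamma> z \<noteq> mat_moebius \<gamma> \<tau>"
  proof eventually_elim
    case (elim z)
    have "mat_moebius \<gamma> z \<noteq> mat_moebius \<gamma> \<tau>"
    proof
      assume eq: "mat_moebius \<gamma> z = mat_moebius \<gamma> \<tau>"
      have "of_int (\<gamma>$1$1) * of_int (\<gamma>$2$2) - of_int (\<gamma>$1$2) * of_int (\<gamma>$2$1) \<noteq> (0 :: complex)"
        by (subst of_int_det_2[OF assms(1)]) simp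
      hence "moebius (of_int (\<gamma>$2$2)) (- of_int (\<gamma>$1$2)) (- of_int (\<gamma>$2$1)) (of_int (\<gamma>$1$1)) (mat_moebius \<gamma> w) = w"
        if "w \<in> upper_half_plane" for w
        unfolding mat_moebius_def
        by (intro moebius_inverse) (use cocycle_nonzero[OF assms(1) that] in \<open>auto simp: cocycle_def\<close>)
      from this[of z] this[of \<tau>] show False
        using elim assms(2) eq by simp
    qed
    thus ?case .
  qed
qed

section \<open>Orbits of bases and the lattices they span\<close>

lemma pair_act_mult: "pair_act (\<delta> ** \<gamma>) p = pair_act \<delta> (pair_act \<gamma> p)"
  by (cases p) (simp add: pair_act_def matrix_matrix_mult_def sum_2 algebra_simps)

lemma pair_act_1: "pair_act \<gamma> (1, \<tau>) = (cocycle \<gamma> \<tau>, of_int (\<gamma>$1$1) * \<tau> + of_int (\<gamma>$1$2))"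
  by (simp add: pair_act_def cocycle_def)

text \<open>Moving the base point by \<gamma> replaces \<Gamma> by its right translate
  \<Gamma>\<gamma>, which is \<Gamma> again.\<close>

lemma pair_class_pair_act:
  assumes "subgroup \<Gamma> SL2Z" and "\<gamma> \<in> \<Gamma>" and "pair_act \<gamma> (\<omega>1, \<omega>2) = (\<omega>1', \<omega>2')"
  shows "pair_class \<Gamma> \<omega>1' \<omega>2' = pair_class \<Gamma> \<omega>1 \<omega>2"
proof -
  interpret subgroup \<Gamma> SL2Z by fact
  interpret group SL2Z by (rule group_SL2Z)
  have "pair_class \<Gamma> \<omega>1' \<omega>2' = (\<lambda>\<delta>. pair_act \<delta> (\<omega>1, \<omega>2)) ` ((\<lambda>\<delta>. \<delta> ** \<gamma>) ` \<Gamma>)"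
    by (simp add: pair_class_def image_image pair_act_mult assms(3))
  also have "(\<lambda>\<delta>. \<delta> ** \<gamma>) ` \<Gamma> = \<Gamma>"
  proof (intro equalityI subsetI)
    fix \<delta> assume "\<delta> \<in> \<Gamma>"
    hence "\<delta> \<otimes>\<^bsub>SL2Z\<^esub> inv\<^bsub>SL2Z\<^esub> \<gamma> \<in> \<Gamma>" "\<delta> \<otimes>\<^bsub>SL2Z\<^esub> inv\<^bsub>SL2Z\<^esub> \<gamma> \<otimes>\<^bsub>SL2Z\<^esub> \<gamma> = \<delta>"
      using assms(2) mem_carrier by (auto simp only: m_closed m_inv_closed m_assoc l_inv r_one inv_closed)
    thus "\<delta> \<in> (\<lambda>\<delta>. \<delta> ** \<gamma>) ` \<Gamma>"
      by (metis SL2Z_simps(2) imageI)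
  qed (use assms(2) subgroup.m_closed[OF assms(1)] in auto)
  finally show ?thesis
    by (simp add: pair_class_def)
qed

lemma lattice_pair_act_subset:
  assumes "pair_act \<gamma> (\<omega>1, \<omega>2) = (\<omega>1', \<omega>2')"
  shows "lattice \<omega>1' \<omega>2' \<subseteq> lattice \<omega>1 \<omega>2"
proof
  fix x assume "x \<in> lattice \<omega>1' \<omega>2'"
  then obtain m n where "x = of_int m * \<omega>1' + of_int n * \<omega>2'"
    by (auto simp: lattice_def)
  hence "x = of_int (m * \<gamma>$2$2 + n * \<gamma>$1$2) * \<omega>1 + of_int (m * \<gamma>$2$1 + n * \<gamma>$1$1) * \<omega>2"
    using assms by (auto simp: pair_act_def algebra_simps)
  thus "x \<in> lattice \<omega>1 \<omega>2"
    unfolding lattice_def by blast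
qed

lemma pair_act_mat_1 [simp]: "pair_act (mat 1) p = p"
  by (cases p) (simp add: pair_act_def mat_def)

text \<open>The inclusion applies to \<gamma> and to its inverse \<delta>.\<close>

lemma lattice_pair_act:
  assumes "det \<gamma> = 1" and "pair_act \<gamma> (\<omega>1, \<omega>2) = (\<omega>1', \<omega>2')"
  shows "lattice \<omega>1' \<omega>2' = lattice \<omega>1 \<omega>2"
proof -
  obtain \<delta> where "\<delta> ** \<gamma> = mat 1"
    using group.l_inv_ex[OF group_SL2Z, of \<gamma>] assms(1) by auto
  hence "pair_act \<delta> (\<omega>1', \<omega>2') = (\<omega>1, \<omega>2)"
    by (metis assms(2) pair_act_mult pair_act_mat_1)
  thus ?thesis
    using assms(2) lattice_pair_act_subset by blast
qed

lemma lattice_scale: "lattice (\<alpha> * \<omega>1) (\<alpha> * \<omega>2) = (*) \<alpha> ` lattice \<omega>1 \<omega>2"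
proof -
  have "\<alpha> * (of_int m * \<omega>1 + of_int n * \<omega>2) = of_int m * (\<alpha> * \<omega>1) + of_int n * (\<alpha> * \<omega>2)" for m n
    by (simp add: algebra_simps)
  moreover have "(*) \<alpha> ` lattice \<omega>1 \<omega>2 = {\<alpha> * (of_int m * \<omega>1 + of_int n * \<omega>2) | m n. True}"
    by (auto simp: lattice_def)
  ultimately show ?thesis
    by (simp add: lattice_def)
qed

text \<open>The basis (c \<tau> + d, a \<tau> + b) of the same lattice is c \<tau> + d times (1,
  \<gamma>\<tau>).\<close>

lemma lattice_mat_moebius:
  assumes "det \<gamma> = 1" and "\<tau> \<in> upper_half_plane"
  shows "lattice 1 \<tau> = (*) (cocycle \<gamma> \<tau>) ` lattice 1 (mat_moebius \<gamma> \<tau>)"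
  unfolding lattice_scale[symmetric] cocycle_mult_mat_moebius[OF assms] mult_1_right
  by (rule lattice_pair_act[OF assms(1) pair_act_1, symmetric])

text \<open>The summands of the eta series are homogeneous of degree - 1 in w and \<omega> together,
  also at \<omega> = 0.\<close>

lemma eta_scale:
  assumes "zeta_lattice \<Lambda>" and "\<alpha> \<noteq> 0" and "w \<in> \<Lambda>"
  shows "eta ((*) \<alpha> ` \<Lambda>) (\<alpha> * w) = eta \<Lambda> w / \<alpha>"
proof -
  have eq: "eta_term (\<alpha> * w) (\<alpha> * \<omega>) = 1 / \<alpha> * eta_term w \<omega>" for \<omega>
  proof -
    have "\<alpha> * w / 2 - \<alpha> * \<omega> = \<alpha> * (w / 2 - \<omega>)" "\<alpha> * w / 2 + \<alpha> * \<omega> = \<alpha> * (w / 2 + \<omega>)"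
      by (simp_all add: algebra_simps)
    thus ?thesis
      using assms(2) by (simp add: eta_term_def distrib_left power2_eq_square)
  qed
  have "eta ((*) \<alpha> ` \<Lambda>) (\<alpha> * w) = infsum (eta_term (\<alpha> * w)) ((*) \<alpha> ` \<Lambda>)"
    by (intro zeta_lattice.eta_eq zeta_lattice_scale assms imageI)
  also have "\<dots> = (\<Sum>\<^sub>\<infinity>\<omega>\<in>\<Lambda>. 1 / \<alpha> * eta_term w \<omega>)"
    using assms(2) by (subst infsum_reindex) (auto simp: inj_on_def o_def eq)
  also have "\<dots> = 1 / \<alpha> * infsum (eta_term w) \<Lambda>"
    by (rule infsum_cmult_right')
  finally show ?thesis
    using zeta_lattice.eta_eq[OF assms(1,3)] by simp
qed

lemma eta_mat_moebius:
  assumes "det \<gamma> = 1" and "\<tau> \<in> upper_half_plane" and "w \<in> lattice 1 (mat_moebius \<gamma> \<tau>)"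
  shows "eta (lattice 1 \<tau>) (cocycle \<gamma> \<tau> * w) = eta (lattice 1 (mat_moebius \<gamma> \<tau>)) w / cocycle \<gamma> \<tau>"
  unfolding lattice_mat_moebius[OF assms(1,2)]
  by (intro eta_scale zeta_lattice_upper_half_plane mat_moebius_upper_half_plane cocycle_nonzero assms)

section \<open>Additivity of quasi-periods\<close>

lemma quasi_period_shift:
  assumes "quasi_periodic \<Lambda> F" and "\<exists>z. F z \<noteq> None" and "\<omega> \<in> \<Lambda>"
  shows "F (z + \<omega>) = F z \<oplus>\<^sub>s Some (quasi_period F \<omega>)"
proof -
  obtain h where h: "\<And>z. F (z + \<omega>) = F z \<oplus>\<^sub>s Some h"
    using assms(1,3) by (auto simp: quasi_periodic_def)
  moreover have "quasi_period F \<omega> = h"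
    by (rule quasi_period_eqI[OF assms(2) h])
  ultimately show ?thesis
    by simp
qed

lemma sphere_add_Some_assoc: "x \<oplus>\<^sub>s Some a \<oplus>\<^sub>s Some b = x \<oplus>\<^sub>s Some (a + b)"
  by (cases x) auto

context zeta_lattice
begin

lemma quasi_period_add:
  assumes "quasi_periodic \<Lambda> F" and "\<exists>z. F z \<noteq> None" and "x \<in> \<Lambda>" and "y \<in> \<Lambda>"
  shows "quasi_period F (x + y) = quasi_period F x + quasi_period F y"
proof (rule quasi_period_eqI[OF assms(2)])
  fix z
  have "F (z + x + y) = F z \<oplus>\<^sub>s Some (quasi_period F x) \<oplus>\<^sub>s Some (quasi_period F y)"
    using quasi_period_shift[OF assms(1,2)] assms(3,4) by simp
  thus "F (z + (x + y)) = F z \<oplus>\<^sub>s Some (quasi_period F x + quasi_period F y)"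
    by (simp add: sphere_add_Some_assoc add.assoc)
qed

text \<open>Membership is part of the induction because additivity is available only inside
  \<Lambda>. At m = 0 additivity for 0 + 0 forces the value 0; going down, the relation for (i - 1)
  * x + x is solved for the smaller multiple.\<close>

lemma quasi_period_of_int:
  assumes "quasi_periodic \<Lambda> F" and "\<exists>z. F z \<noteq> None" and "x \<in> \<Lambda>"
  shows "of_int m * x \<in> \<Lambda> \<and> quasi_period F (of_int m * x) = of_int m * quasi_period F x"
proof (induction m rule: int_induct[of _ 0])
  case base
  show ?case
    using quasi_period_add[OF assms(1,2) zero_mem zero_mem] zero_mem by simp
next
  case (step1 i)
  thus ?case
    using quasi_period_add[OF assms(1,2), of "of_int i * x" x] add_mem[of "of_int i * x" x] assms(3)
    by (simp add: algebra_simps)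
next
  case (step2 i)
  hence "of_int i * x - x \<in> \<Lambda>"
    using diff_mem assms(3) by blast
  thus ?case
    using quasi_period_add[OF assms(1,2), of "of_int i * x - x" x] step2 assms(3)
    by (simp add: algebra_simps)
qed

lemma quasi_period_combination:
  assumes "quasi_periodic \<Lambda> F" and "\<exists>z. F z \<noteq> None" and "x \<in> \<Lambda>" and "y \<in> \<Lambda>"
  shows "quasi_period F (of_int m * x + of_int n * y) =
    of_int m * quasi_period F x + of_int n * quasi_period F y"
  using quasi_period_of_int[OF assms(1,2,3), of m] quasi_period_of_int[OF assms(1,2,4), of n]
    quasi_period_add[OF assms(1,2)] by simp

end

lemma eta_combination:
  assumes "\<tau> \<in> upper_half_plane"
  shows "eta (lattice 1 \<tau>) (of_int m + of_int n * \<tau>) =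
    of_int m * eta (lattice 1 \<tau>) 1 + of_int n * eta (lattice 1 \<tau>) \<tau>"
proof -
  interpret zeta_lattice "lattice 1 \<tau>"
    by (rule zeta_lattice_upper_half_plane) fact
  from quasi_period_combination[OF quasi_periodic_weierstrass_zeta weierstrass_zeta_finite one_in_lattice tau_in_lattice, of m n]
  show ?thesis
    by (simp add: eta_def)
qed

section \<open>Extended values of meromorphic functions as limits\<close>

lemma mero_val_cong:
  assumes "\<forall>\<^sub>F w in at z. f w = g w"
  shows "mero_val f z = mero_val g z"
  using is_pole_cong[OF assms refl] remove_sings_cong[OF assms refl] by (simp add: mero_val_def)

lemma mero_val_tendsto: "f \<midarrow>z\<rightarrow> c \<Longrightarrow> mero_val f z = Some c"
  unfolding mero_val_def is_pole_def
  using not_tendsto_and_filterlim_at_infinity[of "at z" f c] by auto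

lemma mero_val_pole: "filterlim f at_infinity (at z) \<Longrightarrow> mero_val f z = None"
  by (simp add: mero_val_def is_pole_def)

text \<open>Essential singularities being excluded, \<open>mero_val\<close> can always be read off a
  limit over a punctured neighbourhood. Identities in \<complex> \<union> {\<infinity>} thereby
  reduce to computations with limits.\<close>

lemma meromorphic_at_cases:
  assumes "f meromorphic_on {z}"
  obtains "filterlim f at_infinity (at z)" "mero_val f z = None"
    | c where "f \<midarrow>z\<rightarrow> c" "mero_val f z = Some c"
proof -
  have "(\<exists>c. f \<midarrow>z\<rightarrow> c) \<or> filterlim f at_infinity (at z)"
    using meromorphic_on_not_essential[OF assms] by (simp add: not_essential_def is_pole_def)
  thus thesis
    using that(1)[OF _ mero_val_pole] that(2)[OF _ mero_val_tendsto] by blast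
qed

lemma mero_val_compose:
  assumes "f meromorphic_on {z'}" and "filterlim g (at z') (at z)"
  shows "mero_val (\<lambda>w. f (g w)) z = mero_val f z'"
  using assms(1)
proof (cases rule: meromorphic_at_cases)
  case 1
  thus ?thesis
    using filterlim_compose[OF 1(1) assms(2)] by (simp add: mero_val_pole)
next
  case (2 c)
  thus ?thesis
    using filterlim_compose[OF 2(1) assms(2)] by (simp add: mero_val_tendsto)
qed

lemma mero_val_mult:
  assumes "f meromorphic_on {z}" and "h \<midarrow>z\<rightarrow> a" and "a \<noteq> 0"
  shows "mero_val (\<lambda>w. h w * f w) z = a \<cdot>\<^sub>s mero_val f z"
  using assms(1)
proof (cases rule: meromorphic_at_cases)
  case 1
  hence "filterlim (\<lambda>w. h w * f w) at_infinity (at z)"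
    by (intro tendsto_mult_filterlim_at_infinity[OF assms(2,3)])
  thus ?thesis
    using 1 by (simp add: mero_val_pole sphere_scale_def)
next
  case (2 c)
  hence "(\<lambda>w. h w * f w) \<midarrow>z\<rightarrow> a * c"
    by (intro tendsto_mult assms)
  thus ?thesis
    using 2 by (simp add: mero_val_tendsto sphere_scale_def)
qed

text \<open>The eventual condition rules out that f is constantly - d / c near z: there division by
  zero would give the value 0 on the left, whereas \<open>sphere_moebius\<close> gives
  \<infinity>.\<close>

lemma mero_val_moebius:
  assumes "f meromorphic_on {z}" and "det \<gamma> = 1"
    and "\<forall>\<^sub>F w in at z. cocycle \<gamma> (f w) \<noteq> 0"
  shows "mero_val (\<lambda>w. mat_moebius \<gamma> (f w)) z = sphere_moebius \<gamma> (mero_val f z)"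
proof -
  define a b c d :: complex where "a = of_int (\<gamma>$1$1)" and "b = of_int (\<gamma>$1$2)"
    and "c = of_int (\<gamma>$2$1)" and "d = of_int (\<gamma>$2$2)"
  have det: "a * d - b * c = 1"
    using of_int_det_2[OF assms(2)] by (simp add: a_def b_def c_def d_def)
  have M: "mat_moebius \<gamma> = (\<lambda>w. (a * w + b) / (c * w + d))"
    by (simp add: mat_moebius_def moebius_def a_def b_def c_def d_def)
  have S: "sphere_moebius \<gamma> None = (if c = 0 then None else Some (a / c))"
    "sphere_moebius \<gamma> (Some w) = (if c * w + d = 0 then None else Some ((a * w + b) / (c * w + d)))" for w
    by (simp_all add: sphere_moebius_def M a_def b_def c_def d_def)
  have ev: "\<forall>\<^sub>F w in at z. c * f w + d \<noteq> 0"
    using assms(3) by (simp add: cocycle_def c_def d_def)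
  show ?thesis
    using assms(1)
  proof (cases rule: meromorphic_at_cases)
    case 1
    show ?thesis
    proof (cases "c = 0")
      case True
      with det have "a \<noteq> 0" "d \<noteq> 0"
        by auto
      have "filterlim (\<lambda>w. b / d + a / d * f w) at_infinity (at z)"
        using \<open>a \<noteq> 0\<close> \<open>d \<noteq> 0\<close>
        by (intro tendsto_add_filterlim_at_infinity[OF tendsto_const] tendsto_mult_filterlim_at_infinity[OF tendsto_const _ 1(1)]) auto
      hence "filterlim (\<lambda>w. mat_moebius \<gamma> (f w)) at_infinity (at z)"
        by (simp add: M True add_divide_distrib add.commute)
      with 1 True show ?thesis
        by (simp add: S mero_val_pole)
    next
      case False
      have "filterlim (\<lambda>w. d + c * f w) at_infinity (at z)"
        using False
        by (intro tendsto_add_filterlim_at_infinity[OF tendsto_const] tendsto_mult_filterlim_at_infinity[OF tendsto_const _ 1(1)]) auto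
      \<comment> \<open>As a d - b c = 1, the quotient (a u + b) / (c u + d) equals a / c - 1 / (c *
        (c u + d)), and the last term vanishes in the limit at a pole of f.\<close>
      hence "(\<lambda>w. a / c - 1 / c * (1 / (d + c * f w))) \<midarrow>z\<rightarrow> a / c - 1 / c * 0"
        by (intro tendsto_intros tendsto_divide_0[OF tendsto_const])
      moreover have "\<forall>\<^sub>F w in at z. a / c - 1 / c * (1 / (d + c * f w)) = mat_moebius \<gamma> (f w)"
        using ev
      proof eventually_elim
        case (elim w)
        have "a / c - 1 / c * (1 / (d + c * f w)) = (a * (c * f w + d) - 1) / (c * (c * f w + d))"
          using elim False by (simp add: divide_simps add.commute)
        also have "a * (c * f w + d) - 1 = c * (a * f w + b)"
          unfolding det[symmetric] by (simp add: algebra_simps)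
        finally show ?case
          using False by (simp add: M)
      qed
      ultimately have "(\<lambda>w. mat_moebius \<gamma> (f w)) \<midarrow>z\<rightarrow> a / c"
        by (simp add: tendsto_cong)
      with 1 False show ?thesis
        by (simp add: S mero_val_tendsto)
    qed
  next
    case (2 w0)
    have num: "(\<lambda>w. a * f w + b) \<midarrow>z\<rightarrow> a * w0 + b" and den: "(\<lambda>w. c * f w + d) \<midarrow>z\<rightarrow> c * w0 + d"
      by (intro tendsto_add tendsto_mult tendsto_const 2(1))+
    show ?thesis
    proof (cases "c * w0 + d = 0")
      case True
      \<comment> \<open>The determinant keeps numerator and denominator from vanishing together, so
        a zero of the denominator gives a genuine pole.\<close>
      have "a * (c * w0 + d) - c * (a * w0 + b) = 1"
        unfolding det[symmetric] by (simp add: algebra_simps)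
      hence "a * w0 + b \<noteq> 0"
        using True by auto
      moreover have "filterlim (\<lambda>w. c * f w + d) (at 0) (at z)"
        using den ev True by (auto simp: filterlim_at)
      ultimately have "filterlim (\<lambda>w. (a * f w + b) / (c * f w + d)) at_infinity (at z)"
        by (intro filterlim_divide_at_infinity[OF num])
      with 2 True show ?thesis
        by (simp add: S M mero_val_pole)
    next
      case False
      hence "(\<lambda>w. (a * f w + b) / (c * f w + d)) \<midarrow>z\<rightarrow> (a * w0 + b) / (c * w0 + d)"
        by (intro tendsto_divide num den)
      with 2 False show ?thesis
        by (simp add: S M mero_val_tendsto)
    qed
  qed
qed

section \<open>Elliptic zeta functions\<close>

lemma sphere_scale_simps [simp]: "a \<cdot>\<^sub>s None = None" "a \<cdot>\<^sub>s Some x = Some (a * x)"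
  by (simp_all add: sphere_scale_def)

lemma sphere_scale_eq_None_iff [simp]: "a \<cdot>\<^sub>s x = None \<longleftrightarrow> x = None"
  by (simp add: sphere_scale_def)

lemma sphere_scale_add: "a \<cdot>\<^sub>s (x \<oplus>\<^sub>s y) = a \<cdot>\<^sub>s x \<oplus>\<^sub>s a \<cdot>\<^sub>s y"
  by (cases x; cases y) (simp_all add: distrib_left)

lemma sphere_scale_scale: "a \<cdot>\<^sub>s b \<cdot>\<^sub>s x = (a * b) \<cdot>\<^sub>s x"
  by (cases x) simp_all

lemma sphere_scale_eq_iff: "a \<noteq> 0 \<Longrightarrow> a \<cdot>\<^sub>s x = a \<cdot>\<^sub>s y \<longleftrightarrow> x = y"
  by (cases x; cases y) simp_all

lemma one_upper_half_plane_lattice_pair: "\<tau> \<in> upper_half_plane \<Longrightarrow> (1, \<tau>) \<in> lattice_pairs"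
  by (simp add: lattice_pairs_def upper_half_plane_def)

lemma regular_points_iff:
  "\<tau> \<in> regular_points \<Gamma> Z \<longleftrightarrow> \<tau> \<in> upper_half_plane \<and> (\<exists>z. Z (pair_class \<Gamma> 1 \<tau>) z \<noteq> None)"
  by (auto simp: regular_points_def degenerate_points_def)

text \<open>Comparison at the basis 1, \<tau> gives a linear system. Subtracting the second equation
  from \<tau> times the first eliminates \<phi> and leaves \<psi>' - \<psi> times the determinant of
  \<open>legendre_nonzero\<close>.\<close>

lemma Phi_Psi_of_eqI:
  assumes "\<tau> \<in> upper_half_plane"
    and "\<And>\<omega>. \<omega> \<in> lattice 1 \<tau> \<Longrightarrow> H_of \<Gamma> Z 1 \<tau> \<omega> = \<phi> * \<omega> + \<psi> * eta (lattice 1 \<tau>) \<omega>"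
  shows "Phi_Psi_of \<Gamma> Z 1 \<tau> = (\<phi>, \<psi>)"
  unfolding Phi_Psi_of_def
proof (rule the_equality)
  fix x assume x: "case x of (\<phi>', \<psi>') \<Rightarrow> \<forall>\<omega>\<in>lattice 1 \<tau>.
    H_of \<Gamma> Z 1 \<tau> \<omega> = \<phi>' * \<omega> + \<psi>' * eta (lattice 1 \<tau>) \<omega>"
  obtain \<phi>' \<psi>' where [simp]: "x = (\<phi>', \<psi>')"
    by (cases x)
  define \<eta>1 \<eta>2 where "\<eta>1 = eta (lattice 1 \<tau>) 1" and "\<eta>2 = eta (lattice 1 \<tau>) \<tau>"
  have eqs: "\<phi>' + \<psi>' * \<eta>1 = \<phi> + \<psi> * \<eta>1" "\<phi>' * \<tau> + \<psi>' * \<eta>2 = \<phi> * \<tau> + \<psi> * \<eta>2"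
    using x assms(2)[OF one_in_lattice] assms(2)[OF tau_in_lattice] one_in_lattice tau_in_lattice
    by (auto simp: \<eta>1_def \<eta>2_def)
  have "(\<psi>' - \<psi>) * (\<tau> * \<eta>1 - \<eta>2) =
      \<tau> * ((\<phi>' + \<psi>' * \<eta>1) - (\<phi> + \<psi> * \<eta>1)) - ((\<phi>' * \<tau> + \<psi>' * \<eta>2) - (\<phi> * \<tau> + \<psi> * \<eta>2))"
    by (simp add: algebra_simps)
  also have "\<dots> = 0"
    by (simp add: eqs)
  finally have "\<psi>' = \<psi>"
    using legendre_nonzero[OF assms(1)] by (simp add: \<eta>1_def \<eta>2_def)
  with eqs show "x = (\<phi>, \<psi>)"
    by simp
qed (use assms(2) in auto)

lemma meromorphic_eta_period:
  "(\<lambda>\<tau>. eta (lattice 1 \<tau>) 1) meromorphic_on upper_half_plane"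
  "(\<lambda>\<tau>. eta (lattice 1 \<tau>) \<tau>) meromorphic_on upper_half_plane"
  using holomorphic_eta_period[of "\<lambda>_. 1"] holomorphic_eta_period[of "\<lambda>\<tau>. \<tau>"]
  by (auto intro!: analytic_on_imp_meromorphic_on simp: analytic_on_open[OF open_upper_half_plane])

section \<open>Transformation laws of a fixed elliptic zeta function\<close>

locale elliptic_zeta_map =
  fixes \<Gamma> :: "(int^2^2) set" and k :: int and Z :: zeta_map
  assumes subgroup: "subgroup \<Gamma> SL2Z" and elliptic: "elliptic_zeta \<Gamma> k Z"
begin

abbreviation H :: "complex \<Rightarrow> complex \<Rightarrow> complex" where
  "H \<tau> \<omega> \<equiv> H_of \<Gamma> Z 1 \<tau> \<omega>"

lemma det_eq_1: "\<gamma> \<in> \<Gamma> \<Longrightarrow> det \<gamma> = 1"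
  using subgroup.subset[OF subgroup] by auto

lemma quasi_periodic: "\<tau> \<in> upper_half_plane \<Longrightarrow> quasi_periodic (lattice 1 \<tau>) (Z (pair_class \<Gamma> 1 \<tau>))"
  using elliptic one_upper_half_plane_lattice_pair unfolding elliptic_zeta_def by blast

lemma homogeneous:
  assumes "\<alpha> \<noteq> 0" and "\<tau> \<in> upper_half_plane"
  shows "Z (pair_class \<Gamma> \<alpha> (\<alpha> * \<tau>)) (\<alpha> * z) = (\<alpha> powi k) \<cdot>\<^sub>s Z (pair_class \<Gamma> 1 \<tau>) z"
proof -
  have "\<forall>(\<omega>1, \<omega>2)\<in>lattice_pairs. \<forall>z. Z (pair_class \<Gamma> (\<alpha> * \<omega>1) (\<alpha> * \<omega>2)) (\<alpha> * z) =
      (\<alpha> powi k) \<cdot>\<^sub>s Z (pair_class \<Gamma> \<omega>1 \<omega>2) z"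
    using elliptic assms(1) unfolding elliptic_zeta_def by blast
  from bspec[OF this one_upper_half_plane_lattice_pair[OF assms(2)]] show ?thesis
    by simp
qed

lemma meromorphic_H:
  "(\<lambda>\<tau>. H \<tau> \<tau>) meromorphic_on upper_half_plane" "(\<lambda>\<tau>. H \<tau> 1) meromorphic_on upper_half_plane"
  using elliptic by (simp_all add: elliptic_zeta_def meromorphic_quasi_period_def)

lemma holomorphic_H_one: "(\<lambda>\<tau>. H \<tau> 1) holomorphic_on regular_points \<Gamma> Z"
  using elliptic by (simp add: elliptic_zeta_def meromorphic_quasi_period_def)

lemma sparse_degenerate: "degenerate_points \<Gamma> Z sparse_in upper_half_plane"
  using elliptic by (simp add: elliptic_zeta_def meromorphic_quasi_period_def)

lemma open_regular_points: "open (regular_points \<Gamma> Z)"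
  unfolding regular_points_def by (intro open_diff_sparse_pts open_upper_half_plane sparse_degenerate)

lemma eventually_regular:
  assumes "\<tau>0 \<in> upper_half_plane"
  shows "\<forall>\<^sub>F \<tau> in at \<tau>0. \<tau> \<in> regular_points \<Gamma> Z"
proof -
  have "\<forall>\<^sub>F \<tau> in at \<tau>0. \<tau> \<notin> degenerate_points \<Gamma> Z"
    using sparse_degenerate assms by (simp add: sparse_in_eventually_iff[OF open_upper_half_plane])
  moreover have "\<forall>\<^sub>F \<tau> in at \<tau>0. \<tau> \<in> upper_half_plane"
    by (rule eventually_at_in_open'[OF open_upper_half_plane assms])
  ultimately show ?thesis
    by eventually_elim (simp add: regular_points_def)
qed

lemma H_combination:
  assumes "\<tau> \<in> regular_points \<Gamma> Z"
  shows "H \<tau> (of_int m + of_int n * \<tau>) = of_int m * H \<tau> 1 + of_int n * H \<tau> \<tau>"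
proof -
  have \<tau>: "\<tau> \<in> upper_half_plane" "\<exists>z. Z (pair_class \<Gamma> 1 \<tau>) z \<noteq> None"
    using assms by (simp_all add: regular_points_iff)
  interpret zeta_lattice "lattice 1 \<tau>"
    by (rule zeta_lattice_upper_half_plane[OF \<tau>(1)])
  show ?thesis
    using quasi_period_combination[OF quasi_periodic[OF \<tau>(1)] \<tau>(2) one_in_lattice tau_in_lattice, of m n]
    by (simp add: H_of_def)
qed

lemma Z_mat_moebius:
  assumes "\<gamma> \<in> \<Gamma>" and "\<tau> \<in> upper_half_plane"
  shows "Z (pair_class \<Gamma> 1 \<tau>) (cocycle \<gamma> \<tau> * z) =
    (cocycle \<gamma> \<tau> powi k) \<cdot>\<^sub>s Z (pair_class \<Gamma> 1 (mat_moebius \<gamma> \<tau>)) z"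
proof -
  have "pair_class \<Gamma> (cocycle \<gamma> \<tau>) (cocycle \<gamma> \<tau> * mat_moebius \<gamma> \<tau>) = pair_class \<Gamma> 1 \<tau>"
    using pair_class_pair_act[OF subgroup assms(1) pair_act_1]
    by (simp add: cocycle_mult_mat_moebius[OF det_eq_1 assms(2)] assms(1))
  thus ?thesis
    using homogeneous[OF cocycle_nonzero mat_moebius_upper_half_plane,
        OF det_eq_1[OF assms(1)] assms(2) det_eq_1[OF assms(1)] assms(2), of z]
    by simp
qed

text \<open>A nonzero scalar neither creates nor removes the value \<infinity>. Regularity at
  \<gamma>\<tau> is what makes the quasi-periods there unique.\<close>

lemma regular_mat_moebius:
  assumes "\<gamma> \<in> \<Gamma>" and "\<tau> \<in> regular_points \<Gamma> Z"
  shows "mat_moebius \<gamma> \<tau> \<in> regular_points \<Gamma> Z"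
proof -
  have \<tau>: "\<tau> \<in> upper_half_plane"
    using assms(2) by (simp add: regular_points_iff)
  obtain z where "Z (pair_class \<Gamma> 1 \<tau>) z \<noteq> None"
    using assms(2) by (auto simp: regular_points_iff)
  hence "Z (pair_class \<Gamma> 1 \<tau>) (cocycle \<gamma> \<tau> * (z / cocycle \<gamma> \<tau>)) \<noteq> None"
    using cocycle_nonzero[OF det_eq_1[OF assms(1)] \<tau>] by simp
  hence "Z (pair_class \<Gamma> 1 (mat_moebius \<gamma> \<tau>)) (z / cocycle \<gamma> \<tau>) \<noteq> None"
    unfolding Z_mat_moebius[OF assms(1) \<tau>] by (simp del: not_None_eq)
  thus ?thesis
    using mat_moebius_upper_half_plane[OF det_eq_1[OF assms(1)] \<tau>] unfolding regular_points_iff by blast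
qed

lemma H_mat_moebius:
  assumes "\<gamma> \<in> \<Gamma>" and "\<tau> \<in> regular_points \<Gamma> Z" and "\<omega> \<in> lattice 1 (mat_moebius \<gamma> \<tau>)"
  shows "H (mat_moebius \<gamma> \<tau>) \<omega> = cocycle \<gamma> \<tau> powi (- k) * H \<tau> (cocycle \<gamma> \<tau> * \<omega>)"
  unfolding H_of_def[of \<Gamma> Z 1 "mat_moebius \<gamma> \<tau>"]
proof (rule quasi_period_eqI)
  define j where "j = cocycle \<gamma> \<tau>"
  have \<tau>: "\<tau> \<in> upper_half_plane" "\<exists>z. Z (pair_class \<Gamma> 1 \<tau>) z \<noteq> None"
    using assms(2) by (simp_all add: regular_points_iff)
  show "\<exists>z. Z (pair_class \<Gamma> 1 (mat_moebius \<gamma> \<tau>)) z \<noteq> None"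
    using regular_mat_moebius[OF assms(1,2)] unfolding regular_points_iff by blast
  have j: "j \<noteq> 0"
    unfolding j_def by (rule cocycle_nonzero[OF det_eq_1[OF assms(1)] \<tau>(1)])
  have mem: "j * \<omega> \<in> lattice 1 \<tau>"
    unfolding j_def lattice_mat_moebius[OF det_eq_1[OF assms(1)] \<tau>(1)] using assms(3) by (rule imageI)
  have cancel: "j powi k * (j powi (- k) * x) = x" for x
    using j by (simp add: power_int_minus field_simps)
  fix z
  \<comment> \<open>The factor \<open>j powi k\<close> is carried along so that the shift takes
    place at \<tau>; being nonzero, it is cancelled at the end.\<close>
  have "j powi k \<cdot>\<^sub>s Z (pair_class \<Gamma> 1 (mat_moebius \<gamma> \<tau>)) (z + \<omega>) = Z (pair_class \<Gamma> 1 \<tau>) (j * z + j * \<omega>)"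
    using Z_mat_moebius[OF assms(1) \<tau>(1), of "z + \<omega>"] by (simp add: j_def distrib_left)
  also have "\<dots> = Z (pair_class \<Gamma> 1 \<tau>) (j * z) \<oplus>\<^sub>s Some (H \<tau> (j * \<omega>))"
    unfolding H_of_def by (rule quasi_period_shift[OF quasi_periodic[OF \<tau>(1)] \<tau>(2) mem])
  also have "\<dots> = j powi k \<cdot>\<^sub>s (Z (pair_class \<Gamma> 1 (mat_moebius \<gamma> \<tau>)) z \<oplus>\<^sub>s Some (j powi (- k) * H \<tau> (j * \<omega>)))"
    using Z_mat_moebius[OF assms(1) \<tau>(1), of z]
    by (simp only: sphere_scale_add sphere_scale_simps cancel flip: j_def)
  finally show "Z (pair_class \<Gamma> 1 (mat_moebius \<gamma> \<tau>)) (z + \<omega>) =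
      Z (pair_class \<Gamma> 1 (mat_moebius \<gamma> \<tau>)) z \<oplus>\<^sub>s Some (cocycle \<gamma> \<tau> powi (- k) * H \<tau> (cocycle \<gamma> \<tau> * \<omega>))"
    using j by (simp add: sphere_scale_eq_iff j_def)
qed

lemma H_mat_moebius_tau:
  assumes "\<gamma> \<in> \<Gamma>" and "\<tau> \<in> regular_points \<Gamma> Z"
  shows "H (mat_moebius \<gamma> \<tau>) (mat_moebius \<gamma> \<tau>) =
    cocycle \<gamma> \<tau> powi (- k) * (of_int (\<gamma>$1$1) * H \<tau> \<tau> + of_int (\<gamma>$1$2) * H \<tau> 1)"
proof -
  have "cocycle \<gamma> \<tau> * mat_moebius \<gamma> \<tau> = of_int (\<gamma>$1$2) + of_int (\<gamma>$1$1) * \<tau>"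
    using cocycle_mult_mat_moebius[OF det_eq_1[OF assms(1)], of \<tau>] assms(2)
    by (simp add: regular_points_iff add.commute)
  thus ?thesis
    unfolding H_mat_moebius[OF assms tau_in_lattice]
    by (simp only: H_combination[OF assms(2)]) (simp add: add.commute)
qed

lemma H_mat_moebius_one:
  assumes "\<gamma> \<in> \<Gamma>" and "\<tau> \<in> regular_points \<Gamma> Z"
  shows "H (mat_moebius \<gamma> \<tau>) 1 =
    cocycle \<gamma> \<tau> powi (- k) * (of_int (\<gamma>$2$1) * H \<tau> \<tau> + of_int (\<gamma>$2$2) * H \<tau> 1)"
proof -
  have "cocycle \<gamma> \<tau> * 1 = of_int (\<gamma>$2$2) + of_int (\<gamma>$2$1) * \<tau>"
    by (simp add: cocycle_def)
  thus ?thesis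
    unfolding H_mat_moebius[OF assms one_in_lattice]
    by (simp only: H_combination[OF assms(2)]) (simp add: add.commute)
qed

text \<open>This is the identity theorem on the connected half-plane. At a regular point H is
  holomorphic, so a nonzero value spreads to a neighbourhood and excludes vanishing off a sparse
  set; a value at a degenerate point would say nothing.\<close>

lemma eventually_H_one_nonzero:
  assumes "\<tau>1 \<in> regular_points \<Gamma> Z" and "H \<tau>1 1 \<noteq> 0" and "\<tau> \<in> upper_half_plane"
  shows "\<forall>\<^sub>F \<tau> in at \<tau>. H \<tau> 1 \<noteq> 0"
proof -
  have \<tau>1: "\<tau>1 \<in> upper_half_plane"
    using assms(1) by (simp add: regular_points_iff)
  have "isCont (\<lambda>\<tau>. H \<tau> 1) \<tau>1"
    using holomorphic_on_imp_continuous_on[OF holomorphic_H_one] assms(1) open_regular_points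
    by (simp add: continuous_on_eq_continuous_at)
  hence "\<forall>\<^sub>F \<tau> in at \<tau>1. H \<tau> 1 \<noteq> 0"
    using assms(2) by (intro tendsto_imp_eventually_ne) (auto simp: isCont_def)
  hence "\<not> (\<forall>\<^sub>F \<tau> in at \<tau>1. H \<tau> 1 = 0)"
    using eventually_elim2[of _ "at \<tau>1" _ "\<lambda>_. False"] by (auto simp: trivial_limit_def[symmetric])
  hence "\<not> (\<forall>\<^sub>F \<tau> in cosparse upper_half_plane. H \<tau> 1 = 0)"
    using \<tau>1 by (auto simp: eventually_cosparse_open_eq[OF open_upper_half_plane])
  hence "\<forall>\<^sub>F \<tau> in cosparse upper_half_plane. H \<tau> 1 \<noteq> 0"
    using meromorphic_imp_constant_or_avoid[OF meromorphic_H(2) open_upper_half_plane connected_upper_half_plane]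
    by blast
  thus ?thesis
    using assms(3) by (simp add: eventually_cosparse_open_eq[OF open_upper_half_plane])
qed

lemma H_quotient_in_Eq:
  assumes "\<tau>1 \<in> regular_points \<Gamma> Z" and "H \<tau>1 1 \<noteq> 0"
  shows "H_quotient \<Gamma> Z \<in> Eq \<Gamma>"
proof -
  define f where "f = (\<lambda>\<tau>. H \<tau> \<tau> / H \<tau> 1)"
  have mero: "f meromorphic_on upper_half_plane"
    unfolding f_def by (intro meromorphic_intros meromorphic_H)
  have Q: "H_quotient \<Gamma> Z = mero_val f"
    by (simp add: H_quotient_def f_def)
  have "mero_val f (mat_moebius \<gamma> \<tau>) = sphere_moebius \<gamma> (mero_val f \<tau>)"
    if \<gamma>: "\<gamma> \<in> \<Gamma>" and \<tau>: "\<tau> \<in> upper_half_plane" for \<gamma> \<tau>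
  proof -
    have det: "det \<gamma> = 1" and \<gamma>\<tau>: "mat_moebius \<gamma> \<tau> \<in> upper_half_plane"
      using det_eq_1[OF \<gamma>] mat_moebius_upper_half_plane[OF _ \<tau>] by auto
    have lim: "filterlim (mat_moebius \<gamma>) (at (mat_moebius \<gamma> \<tau>)) (at \<tau>)"
      by (rule filterlim_mat_moebius[OF det \<tau>])
    \<comment> \<open>Nonvanishing at w makes f w a true quotient. Nonvanishing at \<gamma>w says
      that f w is not the pole of \<gamma>, the condition that \<open>mero_val_moebius\<close> asks
      for.\<close>
    have "\<forall>\<^sub>F w in at \<tau>. H w 1 \<noteq> 0" "\<forall>\<^sub>F w in at \<tau>. H (mat_moebius \<gamma> w) 1 \<noteq> 0"
      using eventually_H_one_nonzero[OF assms \<tau>]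
        eventually_compose_filterlim[OF eventually_H_one_nonzero[OF assms \<gamma>\<tau>] lim] by auto
    with eventually_regular[OF \<tau>]
    have ev: "\<forall>\<^sub>F w in at \<tau>. cocycle \<gamma> (f w) \<noteq> 0 \<and> f (mat_moebius \<gamma> w) = mat_moebius \<gamma> (f w)"
    proof eventually_elim
      case (elim w)
      have j: "cocycle \<gamma> w \<noteq> 0"
        using cocycle_nonzero[OF det] elim(1) by (simp add: regular_points_iff)
      have den: "of_int (\<gamma>$2$1) * H w w + of_int (\<gamma>$2$2) * H w 1 = H w 1 * cocycle \<gamma> (f w)"
        and num: "of_int (\<gamma>$1$1) * H w w + of_int (\<gamma>$1$2) * H w 1 =
          H w 1 * (of_int (\<gamma>$1$1) * f w + of_int (\<gamma>$1$2))"
        using elim(2) by (simp_all add: f_def cocycle_def field_simps)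
      have "cocycle \<gamma> (f w) \<noteq> 0"
        using elim(3) by (auto simp: H_mat_moebius_one[OF \<gamma> elim(1)] den)
      moreover have "f (mat_moebius \<gamma> w) = mat_moebius \<gamma> (f w)"
        unfolding f_def[THEN fun_cong, of "mat_moebius \<gamma> w"]
          H_mat_moebius_one[OF \<gamma> elim(1)] H_mat_moebius_tau[OF \<gamma> elim(1)] den num
          mat_moebius_eq[of \<gamma> "f w"]
        using j elim(2) by simp
      ultimately show ?case
        by blast
    qed
    have "mero_val f (mat_moebius \<gamma> \<tau>) = mero_val (\<lambda>w. f (mat_moebius \<gamma> w)) \<tau>"
      using mero \<gamma>\<tau> lim by (intro mero_val_compose[symmetric]) (auto intro: meromorphic_on_subset)
    also have "\<dots> = mero_val (\<lambda>w. mat_moebius \<gamma> (f w)) \<tau>"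
      by (rule mero_val_cong) (use ev in eventually_elim, simp)
    also have "\<dots> = sphere_moebius \<gamma> (mero_val f \<tau>)"
    proof (rule mero_val_moebius[OF _ det])
      show "f meromorphic_on {\<tau>}"
        using mero \<tau> by (auto intro: meromorphic_on_subset)
      show "\<forall>\<^sub>F w in at \<tau>. cocycle \<gamma> (f w) \<noteq> 0"
        using ev by eventually_elim simp
    qed
    finally show ?thesis .
  qed
  thus ?thesis
    using mero by (auto simp: Eq_def Q sphere_meromorphic_on_def)
qed

text \<open>Cramer's rule for the values at 1 and \<tau>; additivity of both H and eta carries the
  relation from this basis to the whole lattice.\<close>

lemma H_eq_Phi_Psi:
  assumes "\<tau> \<in> regular_points \<Gamma> Z" and "\<omega> \<in> lattice 1 \<tau>"
  shows "H \<tau> \<omega> = Phi_of \<Gamma> Z 1 \<tau> * \<omega> + Psi_of \<Gamma> Z 1 \<tau> * eta (lattice 1 \<tau>) \<omega>"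
    and "Phi_of \<Gamma> Z 1 \<tau> = (H \<tau> \<tau> * eta (lattice 1 \<tau>) 1 - H \<tau> 1 * eta (lattice 1 \<tau>) \<tau>) /
      (\<tau> * eta (lattice 1 \<tau>) 1 - eta (lattice 1 \<tau>) \<tau>)"
    and "Psi_of \<Gamma> Z 1 \<tau> = (\<tau> * H \<tau> 1 - H \<tau> \<tau>) / (\<tau> * eta (lattice 1 \<tau>) 1 - eta (lattice 1 \<tau>) \<tau>)"
proof -
  define \<eta>1 \<eta>2 where "\<eta>1 = eta (lattice 1 \<tau>) 1" and "\<eta>2 = eta (lattice 1 \<tau>) \<tau>"
  define D where "D = \<tau> * \<eta>1 - \<eta>2"
  define \<phi> \<psi> where "\<phi> = (H \<tau> \<tau> * \<eta>1 - H \<tau> 1 * \<eta>2) / D" and "\<psi> = (\<tau> * H \<tau> 1 - H \<tau> \<tau>) / D"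
  have \<tau>: "\<tau> \<in> upper_half_plane"
    using assms(1) by (simp add: regular_points_iff)
  have D: "D \<noteq> 0"
    using legendre_nonzero[OF \<tau>] by (simp add: D_def \<eta>1_def \<eta>2_def)
  have 1: "\<phi> + \<psi> * \<eta>1 = H \<tau> 1"
  proof -
    have "\<phi> + \<psi> * \<eta>1 = (H \<tau> 1 * D) / D"
      unfolding \<phi>_def \<psi>_def by (simp add: D_def algebra_simps flip: add_divide_distrib)
    thus ?thesis
      using D by simp
  qed
  have 2: "\<phi> * \<tau> + \<psi> * \<eta>2 = H \<tau> \<tau>"
  proof -
    have "\<phi> * \<tau> + \<psi> * \<eta>2 = (H \<tau> \<tau> * D) / D"
      unfolding \<phi>_def \<psi>_def by (simp add: D_def algebra_simps flip: add_divide_distrib)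
    thus ?thesis
      using D by simp
  qed
  have eq: "H \<tau> \<omega> = \<phi> * \<omega> + \<psi> * eta (lattice 1 \<tau>) \<omega>" if mem: "\<omega> \<in> lattice 1 \<tau>" for \<omega>
  proof -
    obtain m n where \<omega>: "\<omega> = of_int m + of_int n * \<tau>"
      using mem by (auto simp: lattice_def)
    show ?thesis
      unfolding \<omega> H_combination[OF assms(1)] eta_combination[OF \<tau>]
      by (simp add: algebra_simps flip: 1 2 \<eta>1_def \<eta>2_def)
  qed
  have "Phi_Psi_of \<Gamma> Z 1 \<tau> = (\<phi>, \<psi>)"
    by (rule Phi_Psi_of_eqI[OF \<tau> eq])
  hence PP: "Phi_of \<Gamma> Z 1 \<tau> = \<phi>" "Psi_of \<Gamma> Z 1 \<tau> = \<psi>"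
    by (simp_all add: Phi_of_def Psi_of_def)
  show "H \<tau> \<omega> = Phi_of \<Gamma> Z 1 \<tau> * \<omega> + Psi_of \<Gamma> Z 1 \<tau> * eta (lattice 1 \<tau>) \<omega>"
    unfolding PP by (rule eq[OF assms(2)])
  show "Phi_of \<Gamma> Z 1 \<tau> = (H \<tau> \<tau> * eta (lattice 1 \<tau>) 1 - H \<tau> 1 * eta (lattice 1 \<tau>) \<tau>) /
      (\<tau> * eta (lattice 1 \<tau>) 1 - eta (lattice 1 \<tau>) \<tau>)"
    unfolding PP by (simp add: \<phi>_def D_def \<eta>1_def \<eta>2_def)
  show "Psi_of \<Gamma> Z 1 \<tau> = (\<tau> * H \<tau> 1 - H \<tau> \<tau>) / (\<tau> * eta (lattice 1 \<tau>) 1 - eta (lattice 1 \<tau>) \<tau>)"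
    unfolding PP by (simp add: \<psi>_def D_def \<eta>1_def \<eta>2_def)
qed

lemma Phi_Psi_mat_moebius:
  assumes "\<gamma> \<in> \<Gamma>" and "\<tau> \<in> regular_points \<Gamma> Z"
  shows "Phi_Psi_of \<Gamma> Z 1 (mat_moebius \<gamma> \<tau>) =
    (cocycle \<gamma> \<tau> powi (- k) * cocycle \<gamma> \<tau> * Phi_of \<Gamma> Z 1 \<tau>, cocycle \<gamma> \<tau> powi (- k) / cocycle \<gamma> \<tau> * Psi_of \<Gamma> Z 1 \<tau>)"
proof (rule Phi_Psi_of_eqI)
  have \<tau>: "\<tau> \<in> upper_half_plane"
    using assms(2) by (simp add: regular_points_iff)
  note det = det_eq_1[OF assms(1)]
  show "mat_moebius \<gamma> \<tau> \<in> upper_half_plane"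
    by (rule mat_moebius_upper_half_plane[OF det \<tau>])
  fix \<omega> assume \<omega>: "\<omega> \<in> lattice 1 (mat_moebius \<gamma> \<tau>)"
  have "cocycle \<gamma> \<tau> * \<omega> \<in> lattice 1 \<tau>"
    unfolding lattice_mat_moebius[OF det \<tau>] using \<omega> by (rule imageI)
  from H_eq_Phi_Psi(1)[OF assms(2) this] show "H (mat_moebius \<gamma> \<tau>) \<omega> =
      cocycle \<gamma> \<tau> powi (- k) * cocycle \<gamma> \<tau> * Phi_of \<Gamma> Z 1 \<tau> * \<omega> +
      cocycle \<gamma> \<tau> powi (- k) / cocycle \<gamma> \<tau> * Psi_of \<Gamma> Z 1 \<tau> * eta (lattice 1 (mat_moebius \<gamma> \<tau>)) \<omega>"
    unfolding H_mat_moebius[OF assms \<omega>] eta_mat_moebius[OF det \<tau> \<omega>] by (simp add: algebra_simps)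
qed

lemma Phi_Psi_quotient_in_M2: "Phi_Psi_quotient \<Gamma> Z \<in> M2 \<Gamma>"
proof -
  define f where "f = (\<lambda>\<tau>. Phi_of \<Gamma> Z 1 \<tau> / Psi_of \<Gamma> Z 1 \<tau>)"
  have Q: "Phi_Psi_quotient \<Gamma> Z = mero_val f"
    by (simp add: Phi_Psi_quotient_def f_def)
  \<comment> \<open>At degenerate points \<open>Phi_of\<close> and \<open>Psi_of\<close> come from
    undetermined quasi-periods. Meromorphy is therefore shown for the explicit formula in H and eta,
    which agrees with f at regular points.\<close>
  define g where "g = (\<lambda>\<tau>.
    ((H \<tau> \<tau> * eta (lattice 1 \<tau>) 1 - H \<tau> 1 * eta (lattice 1 \<tau>) \<tau>) /
      (\<tau> * eta (lattice 1 \<tau>) 1 - eta (lattice 1 \<tau>) \<tau>)) /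
    ((\<tau> * H \<tau> 1 - H \<tau> \<tau>) / (\<tau> * eta (lattice 1 \<tau>) 1 - eta (lattice 1 \<tau>) \<tau>)))"
  have "g meromorphic_on upper_half_plane"
    unfolding g_def by (intro meromorphic_intros meromorphic_H meromorphic_eta_period)
  moreover have "\<forall>\<^sub>F w in at \<tau>. g w = f w" if "\<tau> \<in> upper_half_plane" for \<tau>
    using eventually_regular[OF that]
    by eventually_elim (simp only: f_def g_def H_eq_Phi_Psi(2,3)[OF _ one_in_lattice])
  ultimately have mero: "f meromorphic_on upper_half_plane"
    using meromorphic_on_cong[of upper_half_plane g f, OF _ refl] by blast
  have "mero_val f (mat_moebius \<gamma> \<tau>) = (cocycle \<gamma> \<tau>)\<^sup>2 \<cdot>\<^sub>s mero_val f \<tau>"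
    if \<gamma>: "\<gamma> \<in> \<Gamma>" and \<tau>: "\<tau> \<in> upper_half_plane" for \<gamma> \<tau>
  proof -
    have det: "det \<gamma> = 1" and \<gamma>\<tau>: "mat_moebius \<gamma> \<tau> \<in> upper_half_plane"
      using det_eq_1[OF \<gamma>] mat_moebius_upper_half_plane[OF _ \<tau>] by auto
    have "mero_val f (mat_moebius \<gamma> \<tau>) = mero_val (\<lambda>w. f (mat_moebius \<gamma> w)) \<tau>"
      using mero \<gamma>\<tau> filterlim_mat_moebius[OF det \<tau>]
      by (intro mero_val_compose[symmetric]) (auto intro: meromorphic_on_subset)
    also have "\<dots> = mero_val (\<lambda>w. (cocycle \<gamma> w)\<^sup>2 * f w) \<tau>"
    proof (rule mero_val_cong)
      show "\<forall>\<^sub>F w in at \<tau>. f (mat_moebius \<gamma> w) = (cocycle \<gamma> w)\<^sup>2 * f w"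
        using eventually_regular[OF \<tau>]
      proof eventually_elim
        case (elim w)
        have "cocycle \<gamma> w \<noteq> 0"
          using cocycle_nonzero[OF det] elim by (simp add: regular_points_iff)
        \<comment> \<open>Where \<open>Psi_of\<close> vanishes both sides are 0, as x / 0 =
          0.\<close>
        thus ?case
          unfolding f_def
          by (simp add: Phi_of_def[of \<Gamma> Z 1 "mat_moebius \<gamma> w"] Psi_of_def[of \<Gamma> Z 1 "mat_moebius \<gamma> w"]
                Phi_Psi_mat_moebius[OF \<gamma> elim] power2_eq_square)
      qed
    qed
    also have "\<dots> = (cocycle \<gamma> \<tau>)\<^sup>2 \<cdot>\<^sub>s mero_val f \<tau>"
    proof (rule mero_val_mult)
      show "f meromorphic_on {\<tau>}"
        using mero \<tau> by (auto intro: meromorphic_on_subset)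
      show "(\<lambda>w. (cocycle \<gamma> w)\<^sup>2) \<midarrow>\<tau>\<rightarrow> (cocycle \<gamma> \<tau>)\<^sup>2"
        unfolding cocycle_def by (intro tendsto_intros)
      show "(cocycle \<gamma> \<tau>)\<^sup>2 \<noteq> 0"
        using cocycle_nonzero[OF det \<tau>] by simp
    qed
    finally show ?thesis .
  qed
  thus ?thesis
    using mero by (auto simp: M2_def Q sphere_meromorphic_on_def cocycle_def)
qed

end

section \<open>The zeta function attached to a weight two form\<close>

lemma lattice_pairs_upper_half_plane:
  assumes "(\<omega>1, \<omega>2) \<in> lattice_pairs"
  shows "\<omega>1 \<noteq> 0" and "\<omega>2 / \<omega>1 \<in> upper_half_plane" and "lattice \<omega>1 \<omega>2 = (*) \<omega>1 ` lattice 1 (\<omega>2 / \<omega>1)"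
    and "zeta_lattice (lattice \<omega>1 \<omega>2)"
proof -
  show 1: "\<omega>1 \<noteq> 0" and 2: "\<omega>2 / \<omega>1 \<in> upper_half_plane"
    using assms by (simp_all add: lattice_pairs_def upper_half_plane_def)
  show 3: "lattice \<omega>1 \<omega>2 = (*) \<omega>1 ` lattice 1 (\<omega>2 / \<omega>1)"
    using 1 lattice_scale[of \<omega>1 1 "\<omega>2 / \<omega>1"] by simp
  show "zeta_lattice (lattice \<omega>1 \<omega>2)"
    unfolding 3 by (intro zeta_lattice_scale zeta_lattice_upper_half_plane 1 2)
qed

text \<open>With j = c \<tau> + d, the period \<omega>1 picks up the factor j and f (\<omega>2 /
  \<omega>1) the factor j^2; they cancel in the coefficient of z, and the lattice does not
  change.\<close>

lemma example_zeta_pair_act: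
  assumes "f \<in> M2 \<Gamma>" and "\<gamma> \<in> \<Gamma>" and "det \<gamma> = 1" and "(\<omega>1, \<omega>2) \<in> lattice_pairs"
    and "pair_act \<gamma> (\<omega>1, \<omega>2) = (\<omega>1', \<omega>2')"
  shows "example_zeta f \<omega>1' \<omega>2' z = example_zeta f \<omega>1 \<omega>2 z"
proof -
  note \<omega> = lattice_pairs_upper_half_plane[OF assms(4)]
  define \<tau> j where "\<tau> = \<omega>2 / \<omega>1" and "j = cocycle \<gamma> \<tau>"
  have \<tau>: "\<tau> \<in> upper_half_plane" and j: "j \<noteq> 0"
    using \<omega>(2) cocycle_nonzero[OF assms(3)] by (simp_all add: \<tau>_def j_def)
  have \<omega>': "\<omega>1' = \<omega>1 * j" "\<omega>2' = \<omega>1 * (of_int (\<gamma>$1$1) * \<tau> + of_int (\<gamma>$1$2))"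
    using assms(5) \<omega>(1) by (auto simp: pair_act_def \<tau>_def j_def cocycle_def field_simps)
  have quot: "\<omega>2' / \<omega>1' = mat_moebius \<gamma> \<tau>"
    using \<omega>(1) by (simp add: \<omega>' mat_moebius_eq j_def)
  have f: "f (mat_moebius \<gamma> \<tau>) = j\<^sup>2 \<cdot>\<^sub>s f \<tau>"
    using assms(1,2) \<tau> by (simp add: M2_def j_def cocycle_def)
  show ?thesis
    using j \<omega>(1) unfolding example_zeta_def quot f lattice_pair_act[OF assms(3,5)] \<tau>_def[symmetric]
    by (simp add: sphere_scale_scale \<omega>'(1) power_mult_distrib)
qed

text \<open>Both summands have degree - 1: the linear one as - 2 from \<omega>1 plus 1 from
  z.\<close>

lemma example_zeta_scale:
  assumes "\<alpha> \<noteq> 0"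
  shows "example_zeta f (\<alpha> * \<omega>1) (\<alpha> * \<omega>2) (\<alpha> * z) = (1 / \<alpha>) \<cdot>\<^sub>s example_zeta f \<omega>1 \<omega>2 z"
  unfolding example_zeta_def lattice_scale weierstrass_zeta_scale[OF assms] sphere_scale_add sphere_scale_scale
  using assms by (simp add: power2_eq_square mult.assoc mult.left_commute)

lemma example_zeta_shift:
  assumes "zeta_lattice (lattice \<omega>1 \<omega>2)" and "w \<in> lattice \<omega>1 \<omega>2" and "f (\<omega>2 / \<omega>1) = Some v"
  shows "example_zeta f \<omega>1 \<omega>2 (z + w) =
    example_zeta f \<omega>1 \<omega>2 z \<oplus>\<^sub>s Some (v / \<omega>1\<^sup>2 * w + eta (lattice \<omega>1 \<omega>2) w)"
  unfolding example_zeta_def assms(3) zeta_lattice.weierstrass_zeta_shift[OF assms(1,2)]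
    zeta_lattice.eta_eq[OF assms(1,2)]
  by (cases "weierstrass_zeta (lattice \<omega>1 \<omega>2) z") (simp_all add: algebra_simps add_divide_distrib)

lemma example_zeta_infinite: "f (\<omega>2 / \<omega>1) = None \<Longrightarrow> example_zeta f \<omega>1 \<omega>2 z = None"
  by (simp add: example_zeta_def)

text \<open>A function on classes is built from a chosen representative;
  \<open>example_zeta_pair_act\<close> makes the choice harmless.\<close>

definition example_map :: "(complex \<Rightarrow> csphere) \<Rightarrow> zeta_map" where
  "example_map f C = (let p = (SOME p. p \<in> C) in example_zeta f (fst p) (snd p))"

lemma example_map_pair_class:
  assumes "subgroup \<Gamma> SL2Z" and "f \<in> M2 \<Gamma>" and "(\<omega>1, \<omega>2) \<in> lattice_pairs"
  shows "example_map f (pair_class \<Gamma> \<omega>1 \<omega>2) z = example_zeta f \<omega>1 \<omega>2 z"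
proof -
  define p where "p = (SOME p. p \<in> pair_class \<Gamma> \<omega>1 \<omega>2)"
  have "mat 1 \<in> \<Gamma>"
    using subgroup.one_closed[OF assms(1)] by simp
  hence "pair_act (mat 1) (\<omega>1, \<omega>2) \<in> pair_class \<Gamma> \<omega>1 \<omega>2"
    unfolding pair_class_def by (rule imageI)
  hence "p \<in> pair_class \<Gamma> \<omega>1 \<omega>2"
    unfolding p_def by (rule someI)
  then obtain \<gamma> where \<gamma>: "\<gamma> \<in> \<Gamma>" "p = pair_act \<gamma> (\<omega>1, \<omega>2)"
    by (auto simp: pair_class_def)
  have "det \<gamma> = 1"
    using subgroup.subset[OF assms(1)] \<gamma>(1) by auto
  hence "example_zeta f (fst p) (snd p) z = example_zeta f \<omega>1 \<omega>2 z"
    by (rule example_zeta_pair_act[OF assms(2) \<gamma>(1) _ assms(3)]) (simp add: \<gamma>(2))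
  thus ?thesis
    by (simp add: example_map_def Let_def p_def)
qed

lemma example_map_properties:
  assumes "subgroup \<Gamma> SL2Z" and "f \<in> M2 \<Gamma>"
  shows "elliptic_zeta \<Gamma> (- 1) (example_map f)" and "example_map f \<in> zeta_Psi_nonzero \<Gamma>"
    and "\<And>\<tau>. \<tau> \<in> upper_half_plane \<Longrightarrow> Phi_Psi_quotient \<Gamma> (example_map f) \<tau> = f \<tau>"
proof -
  define Z where "Z = example_map f"
  have Z: "Z (pair_class \<Gamma> \<omega>1 \<omega>2) z = example_zeta f \<omega>1 \<omega>2 z" if "(\<omega>1, \<omega>2) \<in> lattice_pairs" for \<omega>1 \<omega>2 z
    unfolding Z_def by (rule example_map_pair_class[OF assms that])
  obtain g where g: "g meromorphic_on upper_half_plane" "\<And>\<tau>. \<tau> \<in> upper_half_plane \<Longrightarrow> f \<tau> = mero_val g \<tau>"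
    using assms(2) by (auto simp: M2_def sphere_meromorphic_on_def)
  \<comment> \<open>This function carries the finite values of \<open>mero_val g\<close>. It is
    holomorphic off the poles, whereas g may have stray values at isolated points.\<close>
  define v where "v = remove_sings g"
  have iso: "isolated_singularity_at g \<tau>" if "\<tau> \<in> upper_half_plane" for \<tau>
    using g(1) that by (simp add: meromorphic_on_altdef)
  have finite_point: "\<exists>z. Z (pair_class \<Gamma> 1 \<tau>) z \<noteq> None" and
    H: "\<And>w. w \<in> lattice 1 \<tau> \<Longrightarrow> H_of \<Gamma> Z 1 \<tau> w = v \<tau> * w + eta (lattice 1 \<tau>) w"
    if \<tau>: "\<tau> \<in> upper_half_plane" "\<not> is_pole g \<tau>" for \<tau>
  proof -
    interpret zeta_lattice "lattice 1 \<tau>"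
      by (rule zeta_lattice_upper_half_plane[OF \<tau>(1)])
    have f: "f (\<tau> / 1) = Some (v \<tau>)"
      using \<tau> g(2) by (simp add: mero_val_def v_def)
    have Z\<tau>: "Z (pair_class \<Gamma> 1 \<tau>) = example_zeta f 1 \<tau>"
      using Z[OF one_upper_half_plane_lattice_pair[OF \<tau>(1)]] by blast
    obtain z where "weierstrass_zeta (lattice 1 \<tau>) z \<noteq> None"
      using weierstrass_zeta_finite by blast
    hence "example_zeta f 1 \<tau> z \<noteq> None"
      using f by (auto simp: example_zeta_def)
    thus fin: "\<exists>z. Z (pair_class \<Gamma> 1 \<tau>) z \<noteq> None"
      unfolding Z\<tau> by blast
    show "H_of \<Gamma> Z 1 \<tau> w = v \<tau> * w + eta (lattice 1 \<tau>) w" if "w \<in> lattice 1 \<tau>" for w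
      unfolding H_of_def
      by (rule quasi_period_eqI[OF fin])
         (use example_zeta_shift[where f = f, OF zeta_lattice_axioms that f] in \<open>simp add: Z\<tau>\<close>)
  qed
  \<comment> \<open>At a pole the linear term is infinite for every z, elsewhere zeta supplies a
    finite value; sparseness of the degenerate points thus becomes sparseness of poles.\<close>
  have degenerate: "degenerate_points \<Gamma> Z = {\<tau> \<in> upper_half_plane. is_pole g \<tau>}"
  proof (intro equalityI subsetI)
    fix \<tau> assume "\<tau> \<in> {\<tau> \<in> upper_half_plane. is_pole g \<tau>}"
    hence \<tau>: "\<tau> \<in> upper_half_plane" "f \<tau> = None"
      using g(2) by (auto simp: mero_val_def)
    hence "Z (pair_class \<Gamma> 1 \<tau>) z = None" for z
      using Z[OF one_upper_half_plane_lattice_pair[OF \<tau>(1)]] by (simp add: example_zeta_infinite)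
    with \<tau> show "\<tau> \<in> degenerate_points \<Gamma> Z"
      by (simp add: degenerate_points_def)
  next
    fix \<tau> assume "\<tau> \<in> degenerate_points \<Gamma> Z"
    thus "\<tau> \<in> {\<tau> \<in> upper_half_plane. is_pole g \<tau>}"
      using finite_point[of \<tau>] by (auto simp: degenerate_points_def)
  qed
  hence regular: "regular_points \<Gamma> Z = {\<tau> \<in> upper_half_plane. \<not> is_pole g \<tau>}"
    by (auto simp: regular_points_def)
  have sparse: "degenerate_points \<Gamma> Z sparse_in upper_half_plane"
    using meromorphic_on_imp_not_pole_cosparse[OF g(1)]
    unfolding eventually_cosparse degenerate by (rule sparse_in_subset2) auto
  have ev_regular: "\<forall>\<^sub>F w in at \<tau>. w \<in> regular_points \<Gamma> Z" if "\<tau> \<in> upper_half_plane" for \<tau>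
  proof -
    have "\<forall>\<^sub>F w in at \<tau>. w \<notin> degenerate_points \<Gamma> Z"
      using sparse that by (simp add: sparse_in_eventually_iff[OF open_upper_half_plane])
    moreover have "\<forall>\<^sub>F w in at \<tau>. w \<in> upper_half_plane"
      by (rule eventually_at_in_open'[OF open_upper_half_plane that])
    ultimately show ?thesis
      by eventually_elim (simp add: regular_points_def)
  qed
  have v_mero: "v meromorphic_on upper_half_plane"
    unfolding v_def by (intro remove_sings_meromorphic g(1))
  have "v analytic_on regular_points \<Gamma> Z"
  proof (subst analytic_on_analytic_at, rule ballI)
    fix \<tau> assume "\<tau> \<in> regular_points \<Gamma> Z"
    thus "v analytic_on {\<tau>}"
      unfolding v_def regular
      by (intro nicely_meromorphic_on_imp_analytic_at[OF remove_sings_nicely_meromorphic[OF g(1)]])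
         (auto simp: iso)
  qed
  hence v_holo: "v holomorphic_on regular_points \<Gamma> Z"
    by (rule analytic_imp_holomorphic)
  \<comment> \<open>The parameter w lets one argument serve both periods 1 and \<tau>.\<close>
  have quasi: "meromorphic_quasi_period \<Gamma> Z w"
    if w: "\<And>\<tau>. w \<tau> = 1 \<or> w \<tau> = \<tau>" "w holomorphic_on UNIV" for w
  proof -
    have mem: "w \<tau> \<in> lattice 1 \<tau>" for \<tau>
      using w(1)[of \<tau>] one_in_lattice[of \<tau>] tau_in_lattice[of \<tau>] by auto
    have eta: "(\<lambda>\<tau>. eta (lattice 1 \<tau>) (w \<tau>)) holomorphic_on upper_half_plane"
      by (rule holomorphic_eta_period) (use w in \<open>auto intro: holomorphic_on_subset\<close>)
    define h where "h = (\<lambda>\<tau>. v \<tau> * w \<tau> + eta (lattice 1 \<tau>) (w \<tau>))"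
    have eq: "H_of \<Gamma> Z 1 \<tau> (w \<tau>) = h \<tau>" if "\<tau> \<in> regular_points \<Gamma> Z" for \<tau>
      using that H[OF _ _ mem] by (simp add: regular h_def)
    have "h holomorphic_on regular_points \<Gamma> Z"
      unfolding h_def
      by (intro holomorphic_intros v_holo holomorphic_on_subset[OF w(2)] holomorphic_on_subset[OF eta])
         (auto simp: regular)
    moreover have "h meromorphic_on upper_half_plane"
      unfolding h_def
      by (intro meromorphic_intros v_mero analytic_on_imp_meromorphic_on)
         (use eta w(2) in \<open>auto simp: analytic_on_open[OF open_upper_half_plane] intro: holomorphic_on_subset\<close>)
    \<comment> \<open>At poles of g the value of \<open>H_of\<close> is undetermined, so h replaces
      it only on punctured neighbourhoods, which is all that meromorphy sees.\<close>
    moreover have "\<forall>\<^sub>F w' in at \<tau>. h w' = H_of \<Gamma> Z 1 w' (w w')" if "\<tau> \<in> upper_half_plane" for \<tau>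
      using ev_regular[OF that] by eventually_elim (simp add: eq)
    ultimately show ?thesis
      unfolding meromorphic_quasi_period_def
      using sparse eq meromorphic_on_cong[of upper_half_plane h "\<lambda>\<tau>. H_of \<Gamma> Z 1 \<tau> (w \<tau>)", OF _ refl]
      by (auto intro: holomorphic_transform[of h])
  qed
  have "quasi_periodic (lattice \<omega>1 \<omega>2) (Z (pair_class \<Gamma> \<omega>1 \<omega>2))" if "(\<omega>1, \<omega>2) \<in> lattice_pairs" for \<omega>1 \<omega>2
  proof (cases "f (\<omega>2 / \<omega>1)")
    case None
    thus ?thesis
      by (simp add: quasi_periodic_def Z[OF that] example_zeta_infinite)
  next
    case (Some c)
    from example_zeta_shift[where f = f, OF lattice_pairs_upper_half_plane(4)[OF that] _ this] show ?thesis
      unfolding quasi_periodic_def Z[OF that] by blast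
  qed
  moreover have "Z (pair_class \<Gamma> (\<alpha> * \<omega>1) (\<alpha> * \<omega>2)) (\<alpha> * z) = (\<alpha> powi (- 1)) \<cdot>\<^sub>s Z (pair_class \<Gamma> \<omega>1 \<omega>2) z"
    if "\<alpha> \<noteq> 0" "(\<omega>1, \<omega>2) \<in> lattice_pairs" for \<alpha> \<omega>1 \<omega>2 z
  proof -
    have "(\<alpha> * \<omega>1, \<alpha> * \<omega>2) \<in> lattice_pairs"
      using that by (simp add: lattice_pairs_def)
    thus ?thesis
      using that by (simp add: Z example_zeta_scale inverse_eq_divide power_int_minus)
  qed
  ultimately have elliptic: "elliptic_zeta \<Gamma> (- 1) Z"
    unfolding elliptic_zeta_def using quasi[of "\<lambda>\<tau>. \<tau>"] quasi[of "\<lambda>_. 1"] by auto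
  have Phi_Psi: "Phi_Psi_of \<Gamma> Z 1 \<tau> = (v \<tau>, 1)" if "\<tau> \<in> regular_points \<Gamma> Z" for \<tau>
    by (rule Phi_Psi_of_eqI) (use that H in \<open>auto simp: regular\<close>)
  \<comment> \<open>Any point of the half-plane would do: regular points lie arbitrarily near it,
    and there \<Psi> = 1.\<close>
  have "\<i> \<in> upper_half_plane"
    by (simp add: upper_half_plane_def)
  from eventually_happens[OF ev_regular[OF this]] obtain \<tau> where "\<tau> \<in> regular_points \<Gamma> Z"
    by auto
  with elliptic have "Z \<in> zeta_Psi_nonzero \<Gamma>"
    unfolding zeta_Psi_nonzero_def by (auto simp: Psi_of_def Phi_Psi intro!: bexI[of _ \<tau>])
  moreover have "Phi_Psi_quotient \<Gamma> Z \<tau> = f \<tau>" if \<tau>: "\<tau> \<in> upper_half_plane" for \<tau>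
  proof -
    have "\<forall>\<^sub>F w in at \<tau>. Phi_of \<Gamma> Z 1 w / Psi_of \<Gamma> Z 1 w = g w"
      using ev_regular[OF \<tau>] eventually_remove_sings_eq_at[OF iso[OF \<tau>]]
      by eventually_elim (simp add: Phi_of_def Psi_of_def Phi_Psi v_def)
    thus ?thesis
      unfolding Phi_Psi_quotient_def g(2)[OF \<tau>] by (rule mero_val_cong)
  qed
  ultimately show "elliptic_zeta \<Gamma> (- 1) (example_map f)" "example_map f \<in> zeta_Psi_nonzero \<Gamma>"
    "\<And>\<tau>. \<tau> \<in> upper_half_plane \<Longrightarrow> Phi_Psi_quotient \<Gamma> (example_map f) \<tau> = f \<tau>"
    using elliptic by (simp_all add: Z_def)
qed

theorem theorem6p2:
  fixes \<Gamma> :: "(int^2^2) set"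
  assumes "subgroup \<Gamma> SL2Z" and "finite (rcosets\<^bsub>SL2Z\<^esub> \<Gamma>)"
  shows "H_quotient \<Gamma> \<in> zeta_H_nonzero \<Gamma> \<rightarrow> Eq \<Gamma> \<and>
    Phi_Psi_quotient \<Gamma> \<in> zeta_Psi_nonzero \<Gamma> \<rightarrow> M2 \<Gamma> \<and>
    (\<forall>f\<in>M2 \<Gamma>. \<exists>Z.
      (\<forall>(\<omega>1, \<omega>2)\<in>lattice_pairs. \<forall>z. Z (pair_class \<Gamma> \<omega>1 \<omega>2) z = example_zeta f \<omega>1 \<omega>2 z) \<and>
      elliptic_zeta \<Gamma> (-1) Z \<and> Z \<in> zeta_Psi_nonzero \<Gamma> \<and>
      (\<forall>\<tau>\<in>upper_half_plane. Phi_Psi_quotient \<Gamma> Z \<tau> = f \<tau>))"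
proof (intro conjI ballI)
  show "H_quotient \<Gamma> \<in> zeta_H_nonzero \<Gamma> \<rightarrow> Eq \<Gamma>"
  proof
    fix Z assume "Z \<in> zeta_H_nonzero \<Gamma>"
    then obtain k \<tau> where "elliptic_zeta \<Gamma> k Z" "\<tau> \<in> regular_points \<Gamma> Z" "H_of \<Gamma> Z 1 \<tau> 1 \<noteq> 0"
      by (auto simp: zeta_H_nonzero_def)
    thus "H_quotient \<Gamma> Z \<in> Eq \<Gamma>"
      by (intro elliptic_zeta_map.H_quotient_in_Eq[of \<Gamma> k Z]) (auto intro: elliptic_zeta_map.intro assms(1))
  qed
  show "Phi_Psi_quotient \<Gamma> \<in> zeta_Psi_nonzero \<Gamma> \<rightarrow> M2 \<Gamma>"
  proof
    fix Z assume "Z \<in> zeta_Psi_nonzero \<Gamma>"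
    then obtain k where "elliptic_zeta \<Gamma> k Z"
      by (auto simp: zeta_Psi_nonzero_def)
    thus "Phi_Psi_quotient \<Gamma> Z \<in> M2 \<Gamma>"
      by (intro elliptic_zeta_map.Phi_Psi_quotient_in_M2[of \<Gamma> k Z] elliptic_zeta_map.intro assms(1))
  qed
next
  fix f assume f: "f \<in> M2 \<Gamma>"
  show "\<exists>Z. (\<forall>(\<omega>1, \<omega>2)\<in>lattice_pairs. \<forall>z. Z (pair_class \<Gamma> \<omega>1 \<omega>2) z = example_zeta f \<omega>1 \<omega>2 z) \<and>
      elliptic_zeta \<Gamma> (-1) Z \<and> Z \<in> zeta_Psi_nonzero \<Gamma> \<and>
      (\<forall>\<tau>\<in>upper_half_plane. Phi_Psi_quotient \<Gamma> Z \<tau> = f \<tau>)"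
    using example_map_pair_class[OF assms(1) f] example_map_properties[OF assms(1) f]
    by (intro exI[of _ "example_map f"]) auto
qed

end
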